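(* Let $m,n,q\ge 1$ and $1\le k\le m$ be integers, let $\alpha\in\mathbb{R}$, let $B_1,\ldots,B_q\in M_{m,n}$, and let $\Phi^{\pm}_{\alpha,\mathfrak B}:M_n\to M_m$ be the maps \[\Phi^{\pm}_{\alpha,\mathfrak B}(X)=\alpha\,\mathrm{tr}(X)I_m\pm\sum_{s=1}^q B_sXB_s^*\quad (X\in M_n).\] Let $Z=[\mathrm{vec}(B_1)\ \cdots\ \mathrm{vec}(B_q)]\in M_{mn,q}$ and define \[\beta_k^{\pm}=\max_{\substack{V\in M_{m,k}\\ V^*V=I_k}}\lambda_{\max}\big((I_n\otimes V)^*(\mp ZZ^* )(I_n\otimes V)\big).\] Then, for each choice of sign, $\Phi^{\pm}_{\alpha,\mathfrak B}$ is $k$-positive if and only if $\alpha\ge\beta_k^{\pm}$ (upper signs go together and lower signs go together).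
   Context: $M_{m,n}$ is the set of $m\times n$ complex matrices, $M_n=M_{n,n}$. For $X\in M_{m,n}$ with columns $x_1,\ldots,x_n$, $\mathrm{vec}(X)\in\mathbb{C}^{mn}$ is the column vector obtained by stacking $x_1,\ldots,x_n$. $\lambda_{\max}(H)$ is the largest eigenvalue of a Hermitian matrix $H$. A linear map $\Phi:M_n\to M_m$ is $k$-positive if for every positive semidefinite block matrix $[A_{ij}]_{i,j=1}^k$ with $A_{ij}\in M_n$, the block matrix $[\Phi(A_{ij})]_{i,j=1}^k$ is positive semidefinite. *)

theory Defs
  imports "Jordan_Normal_Form.Schur_Decomposition" "HOL.Complex"
begin

definition mat_trace :: "complex mat \<Rightarrow> complex" where
  "mat_trace X = (\<Sum>i<dim_row X. X $$ (i, i))"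

(* Column stacking: entry (i, j) of X goes to position j * dim_row X + i. *)
definition vectorize :: "complex mat \<Rightarrow> complex vec" where
  "vectorize X = vec (dim_row X * dim_col X) (\<lambda>r. X $$ (r mod dim_row X, r div dim_row X))"

definition kronecker :: "complex mat \<Rightarrow> complex mat \<Rightarrow> complex mat" where
  "kronecker A B = mat (dim_row A * dim_row B) (dim_col A * dim_col B)
     (\<lambda>(i, j). A $$ (i div dim_row B, j div dim_col B) * B $$ (i mod dim_row B, j mod dim_col B))"

definition positive_semidefinite :: "nat \<Rightarrow> complex mat \<Rightarrow> bool" where
  "positive_semidefinite n A \<longleftrightarrow> A \<in> carrier_mat n n \<and> mat_adjoint A = A \<and>
     (\<forall>v\<in>carrier_vec n. Re ((A *\<^sub>v v) \<bullet>c v) \<ge> 0)"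

definition block_matrix :: "nat \<Rightarrow> nat \<Rightarrow> (nat \<Rightarrow> nat \<Rightarrow> complex mat) \<Rightarrow> complex mat" where
  "block_matrix k d A = mat (k * d) (k * d)
     (\<lambda>(r, c). A (r div d) (c div d) $$ (r mod d, c mod d))"

definition linear_mat_map :: "nat \<Rightarrow> nat \<Rightarrow> (complex mat \<Rightarrow> complex mat) \<Rightarrow> bool" where
  "linear_mat_map n m \<Phi> \<longleftrightarrow>
     (\<forall>X\<in>carrier_mat n n. \<Phi> X \<in> carrier_mat m m) \<and>
     (\<forall>X\<in>carrier_mat n n. \<forall>Y\<in>carrier_mat n n. \<Phi> (X + Y) = \<Phi> X + \<Phi> Y) \<and>
     (\<forall>c. \<forall>X\<in>carrier_mat n n. \<Phi> (c \<cdot>\<^sub>m X) = c \<cdot>\<^sub>m \<Phi> X)"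

definition k_positive :: "nat \<Rightarrow> nat \<Rightarrow> nat \<Rightarrow> (complex mat \<Rightarrow> complex mat) \<Rightarrow> bool" where
  "k_positive k n m \<Phi> \<longleftrightarrow> linear_mat_map n m \<Phi> \<and>
     (\<forall>A. (\<forall>i<k. \<forall>j<k. A i j \<in> carrier_mat n n) \<longrightarrow>
        positive_semidefinite (k * n) (block_matrix k n A) \<longrightarrow>
        positive_semidefinite (k * m) (block_matrix k m (\<lambda>i j. \<Phi> (A i j))))"

(* Intended for Hermitian H, all of whose eigenvalues are real. *)
definition lambda_max :: "complex mat \<Rightarrow> real" where
  "lambda_max H = Max {x. eigenvalue H (complex_of_real x)}"

(* The sign is passed as a real number \<sigma>: 1 gives the upper signs, -1 the lower ones.
   The matrices B_1, ..., B_q are B 0, ..., B (q - 1). *)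
definition Phi_map :: "real \<Rightarrow> nat \<Rightarrow> nat \<Rightarrow> real \<Rightarrow> (nat \<Rightarrow> complex mat) \<Rightarrow> complex mat \<Rightarrow> complex mat"
  where
  "Phi_map \<sigma> m q \<alpha> B X =
     (complex_of_real \<alpha> * mat_trace X) \<cdot>\<^sub>m 1\<^sub>m m
     + complex_of_real \<sigma> \<cdot>\<^sub>m mat m m (\<lambda>ij. \<Sum>s<q. (B s * X * mat_adjoint (B s)) $$ ij)"

definition Z_mat :: "nat \<Rightarrow> nat \<Rightarrow> nat \<Rightarrow> (nat \<Rightarrow> complex mat) \<Rightarrow> complex mat" where
  "Z_mat m n q B = mat_of_cols (m * n) (map (\<lambda>s. vectorize (B s)) [0..<q])"

(* The opposite sign -\<sigma> in front of Z Z^* is the \<mp> matching the \<plusminus> of Phi_map.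
   GREATEST denotes an attained maximum over the (infinite) set of isometries V. *)
definition beta :: "real \<Rightarrow> nat \<Rightarrow> nat \<Rightarrow> nat \<Rightarrow> nat \<Rightarrow> (nat \<Rightarrow> complex mat) \<Rightarrow> real" where
  "beta \<sigma> k m n q B =
     (GREATEST b. b \<in>
       {lambda_max (mat_adjoint (kronecker (1\<^sub>m n) V)
          * (complex_of_real (- \<sigma>) \<cdot>\<^sub>m (Z_mat m n q B * mat_adjoint (Z_mat m n q B)))
          * kronecker (1\<^sub>m n) V)
        | V. V \<in> carrier_mat m k \<and> mat_adjoint V * V = 1\<^sub>m k})"

end

theory Submission
  imports "HOL-Analysis.Function_Topology" "HOL-Analysis.Topology_Euclidean_Space" Defs
begin

text \<open>A positive semidefinite block matrix is a sum of rank-one blocks $A_{ij} = x_i x_j^*$, and on such a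
  block the quadratic form of $[\Phi(A_{ij})]$ at $y = (y_1, \ldots, y_k)$ equals
  $\alpha \|W\|_F^2 \pm \sum_s |\langle B_s, W\rangle|^2$ with $W = \sum_i y_i x_i^*$. Since $k \le m$, the
  columns $y_i$ lie in the range of an isometry $V$, so the matrices $W$ are exactly the products $V U$ with
  $U \in M_{k,n}$. On the other side $(I_n \otimes V)\,\mathrm{vec}(U) = \mathrm{vec}(V U)$, so the Rayleigh
  quotients of the compressed matrix are $\mp\sum_s |\langle B_s, V U\rangle|^2 / \|V U\|_F^2$, and $\beta_k^\pm$ is
  their maximum over all $V$ and $U$, attained by compactness.\<close>

section \<open>Rank-one decompositions and orthonormal frames\<close>

text \<open>\<open>beta\<close> is a \<open>GREATEST\<close> of values of \<open>lambda_max\<close>,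
  itself a \<open>Max\<close> over eigenvalues, while k-positivity only yields inequalities between
  quadratic forms. The bridge is that maximal Rayleigh quotients exist and are eigenvalues. The
  rank-one decomposition serves a second time for this: applied to b I - H, with b the maximal
  Rayleigh quotient of H, it shows that a maximiser is an eigenvector. The term ||W||_F^2 has the
  same origin as the terms |<B_s, W>|^2: the map X -> tr(X) I is the sum of E X E^* over all matrix
  units E, each map X -> K X K^* contributes |<K, W>|^2, and for matrix units these are the squared
  moduli of the entries of W. The vectors y_i may be linearly dependent, so an orthonormal basis of
  their span can be too short; it has to be completed to exactly k vectors, and this is where k <= m
  enters.\<close>

lemma sum_div_mod:
  fixes f :: "nat \<Rightarrow> nat \<Rightarrow> 'a::comm_monoid_add"
  shows "(\<Sum>r<k*d. f (r div d) (r mod d)) = (\<Sum>i<k. \<Sum>j<d. f i j)"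
proof -
  have "(\<Sum>r\<in>{i*d..<i*d+d}. f (r div d) (r mod d)) = (\<Sum>j<d. f i j)" for i
  proof -
    have "(\<Sum>r\<in>{i*d..<i*d+d}. f (r div d) (r mod d)) = (\<Sum>j=0..<d. f ((j + i*d) div d) ((j + i*d) mod d))"
      using sum.shift_bounds_nat_ivl[of "\<lambda>r. f (r div d) (r mod d)" 0 "i*d" d] by (simp add: add.commute)
    also have "\<dots> = (\<Sum>j=0..<d. f i j)" by (intro sum.cong) auto
    finally show ?thesis by (simp add: atLeast0LessThan)
  qed
  then show ?thesis by (simp flip: sum.nat_group)
qed

text \<open>Cholesky elimination: a pivot \<open>p\<close> splits off one rank-one kernel, and
  completing the square shows that the Schur complement on the remaining indices is again positive.
  An arbitrary finite index set lets the induction delete any index.\<close>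

lemma psd_kernel_rank_one_sum:
  fixes a :: "'i \<Rightarrow> 'i \<Rightarrow> complex"
  assumes "finite S"
    and "\<And>i j. i \<in> S \<Longrightarrow> j \<in> S \<Longrightarrow> a j i = cnj (a i j)"
    and "\<And>v. 0 \<le> Re (\<Sum>i\<in>S. \<Sum>j\<in>S. cnj (v i) * a i j * v j)"
  shows "\<exists>(N::nat) g. \<forall>i\<in>S. \<forall>j\<in>S. a i j = (\<Sum>l<N. g l i * cnj (g l j))"
  using assms
proof (induction S arbitrary: a rule: finite_induct)
  case empty
  then show ?case by simp
next
  case (insert p S)
  note herm = insert.prems(1) and psd = insert.prems(2)
  define d where "d = Re (a p p)"
  have app: "a p p = of_real d"
    using herm[of p p] by (simp add: d_def complex_eq_iff)
  \<comment> \<open>The form at the vector with value \<open>t\<close> at the pivot and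
    \<open>v\<close> elsewhere, as a quadratic in \<open>t\<close>. Choosing \<open>t\<close> gives
    \<open>d >= 0\<close>, the vanishing of the pivot row when \<open>d = 0\<close>, and the
    positivity of the Schur complement.\<close>
  have expand: "0 \<le> Re (\<Sum>i\<in>S. \<Sum>j\<in>S. cnj (v i) * a i j * v j)
      + 2 * Re (cnj t * (\<Sum>j\<in>S. a p j * v j)) + d * (cmod t)\<^sup>2" for v t
  proof -
    define w where "w = (\<lambda>i. if i = p then t else v i)"
    have w: "w p = t" "\<And>i. i \<in> S \<Longrightarrow> w i = v i"
      using insert.hyps by (auto simp: w_def)
    define s where "s = (\<Sum>j\<in>S. a p j * v j)"
    have s: "(\<Sum>i\<in>S. cnj (v i) * a i p) = cnj s"
      unfolding s_def cnj_sum by (intro sum.cong refl) (metis complex_cnj_mult herm insertCI mult.commute)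
    have "(\<Sum>i\<in>insert p S. \<Sum>j\<in>insert p S. cnj (w i) * a i j * w j)
       = cnj t * a p p * t + cnj t * s + (\<Sum>i\<in>S. cnj (v i) * a i p) * t
         + (\<Sum>i\<in>S. \<Sum>j\<in>S. cnj (v i) * a i j * v j)"
      using insert.hyps w
      by (simp add: s_def sum.distrib sum_distrib_left sum_distrib_right mult.assoc)
    then have "0 \<le> Re (cnj t * a p p * t + cnj t * s + cnj s * t
         + (\<Sum>i\<in>S. \<Sum>j\<in>S. cnj (v i) * a i j * v j))"
      using psd[of w] s by simp
    then show ?thesis
      unfolding s_def[symmetric] app cmod_power2 by (simp add: power2_eq_square algebra_simps)
  qed
  have d0: "d \<ge> 0"
    using expand[of "\<lambda>_. 0" 1] by simp
  \<comment> \<open>Without the quadratic term, the bound along \<open>t = - c * a p j\<close> is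
    affine in the real number \<open>c\<close> with slope \<open>- 2 * (cmod (a p j))^2\<close>. The
    value of \<open>c\<close> chosen at the end would make it -1.\<close>
  have zero: "a p j = 0" if "d = 0" "j \<in> S" for j
  proof (rule ccontr)
    assume nz: "a p j \<noteq> 0"
    define v where "v = (\<lambda>i. if i = j then 1 else 0 :: complex)"
    define Q where "Q = Re (\<Sum>i\<in>S. \<Sum>j\<in>S. cnj (v i) * a i j * v j)"
    have s: "(\<Sum>j\<in>S. a p j * v j) = a p j"
      using that insert.hyps by (simp add: v_def if_distrib cong: if_cong)
    have "0 \<le> Q - 2 * c * (cmod (a p j))\<^sup>2" for c :: real
      using expand[of v "- of_real c * a p j"]
      unfolding that(1) s Q_def[symmetric]
      by (simp add: cmod_power2[unfolded power2_eq_square] power2_eq_square algebra_simps)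
    from this[of "(Q + 1) / (2 * (cmod (a p j))\<^sup>2)"] nz show False by simp
  qed
  \<comment> \<open>The Schur complement; for \<open>d = 0\<close> the division by zero yields \<open>b = a\<close>, which is then correct.\<close>
  define b where "b = (\<lambda>i j. a i j - a i p * a p j / of_real d)"
  have "\<exists>(N::nat) g. \<forall>i\<in>S. \<forall>j\<in>S. b i j = (\<Sum>l<N. g l i * cnj (g l j))"
  proof (rule insert.IH)
    show "b j i = cnj (b i j)" if "i \<in> S" "j \<in> S" for i j
      using that herm[of i j] herm[of i p] herm[of p j] by (simp add: b_def mult.commute)
    show "0 \<le> Re (\<Sum>i\<in>S. \<Sum>j\<in>S. cnj (v i) * b i j * v j)" for v
    proof -
      define s where "s = (\<Sum>j\<in>S. a p j * v j)"
      have s: "(\<Sum>i\<in>S. cnj (v i) * a i p) = cnj s"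
        unfolding s_def cnj_sum by (intro sum.cong refl) (metis complex_cnj_mult herm insertCI mult.commute)
      have cs: "cnj s * s = of_real ((cmod s)\<^sup>2)"
        by (simp add: complex_norm_square mult.commute del: of_real_power)
      have "(\<Sum>i\<in>S. \<Sum>j\<in>S. cnj (v i) * b i j * v j) =
         (\<Sum>i\<in>S. \<Sum>j\<in>S. cnj (v i) * a i j * v j) - (\<Sum>i\<in>S. cnj (v i) * a i p) * s / of_real d"
        unfolding b_def s_def sum_product sum_divide_distrib sum_subtractf[symmetric]
        by (intro sum.cong refl) (simp add: algebra_simps)
      also have "Re \<dots> = Re (\<Sum>i\<in>S. \<Sum>j\<in>S. cnj (v i) * a i j * v j) - (cmod s)\<^sup>2 / d"
        unfolding s cs by (simp flip: of_real_divide del: of_real_power)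
      also have "\<dots> \<ge> 0"
      proof -
        \<comment> \<open>For \<open>d > 0\<close> the value \<open>t = - s / d\<close> minimises
          the quadratic in \<open>expand\<close>, and the minimum is the form of \<open>b\<close> at
          \<open>v\<close>. For \<open>d = 0\<close> it degenerates to \<open>t = 0\<close>, and the
          subtracted quotient is 0 as well.\<close>
        have "cnj (- s / of_real d) * s = of_real (- (cmod s)\<^sup>2 / d)"
          using cs by (simp del: of_real_power)
        then have re: "Re (cnj (- s / of_real d) * s) = - ((cmod s)\<^sup>2 / d)"
          by (simp only: Re_complex_of_real minus_divide_left)
        have sq: "d * (cmod (- s / of_real d))\<^sup>2 = (cmod s)\<^sup>2 / d"
          by (simp add: norm_divide power_divide power2_eq_square)
        show ?thesis
          using expand[of v "- s / of_real d", folded s_def, unfolded re sq] by linarith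
      qed
      finally show ?thesis .
    qed
  qed
  then obtain N g where g: "\<And>i j. i \<in> S \<Longrightarrow> j \<in> S \<Longrightarrow> b i j = (\<Sum>l<N::nat. g l i * cnj (g l j))"
    by blast
  \<comment> \<open>The new factor is the pivot column divided by the square root of the pivot; the
    factors of the Schur complement are extended by zero to \<open>p\<close>.\<close>
  define g' where "g' = (\<lambda>l i. if l = N then a i p / of_real (sqrt d) else if i = p then 0 else g l i)"
  have last: "g' N i * cnj (g' N j) = a i p * a p j / of_real d" if "i \<in> insert p S" "j \<in> insert p S" for i j
    using herm[of j p] that d0 by (simp add: g'_def flip: of_real_mult)
  have "a i j = (\<Sum>l<Suc N. g' l i * cnj (g' l j))" if "i \<in> insert p S" "j \<in> insert p S" for i j
  proof (cases "i = p \<or> j = p")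
    case True
    then have "(\<Sum>l<N. g' l i * cnj (g' l j)) = 0" by (intro sum.neutral) (auto simp: g'_def)
    moreover have "a i p * a p j / of_real d = a i j"
      using True that zero herm[of p i] app by (cases "d = 0") auto
    ultimately show ?thesis using last[OF that] by simp
  next
    case False
    then have "(\<Sum>l<N. g' l i * cnj (g' l j)) = (\<Sum>l<N. g l i * cnj (g l j))"
      by (intro sum.cong) (auto simp: g'_def)
    then show ?thesis using g[of i j] that False last[OF that] by (simp add: b_def diff_eq_eq)
  qed
  then show ?case by blast
qed

text \<open>A Gram-Schmidt step that also covers dependence. A nonzero residual of \<open>x\<close>
  is normalised to \<open>w\<close>; if the residual vanishes, \<open>c = 0\<close> and
  \<open>w\<close> is the normalised residual of a standard basis vector, one of which is nonzero
  because \<open>k < m\<close>.\<close>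

lemma orthonormal_extend:
  fixes V :: "nat \<Rightarrow> nat \<Rightarrow> complex"
  assumes km: "k < m"
    and on: "\<And>i j. i < k \<Longrightarrow> j < k \<Longrightarrow> (\<Sum>a<m. cnj (V i a) * V j a) = (if i = j then 1 else 0)"
  obtains w c where "(\<Sum>a<m. cnj (w a) * w a) = 1"
    and "\<And>i. i < k \<Longrightarrow> (\<Sum>a<m. cnj (V i a) * w a) = 0"
    and "\<And>a. a < m \<Longrightarrow> x a = (\<Sum>l<k. V l a * (\<Sum>b<m. cnj (V l b) * x b)) + c * w a"
proof -
  define res where "res = (\<lambda>x a. x a - (\<Sum>l<k. V l a * (\<Sum>b<m. cnj (V l b) * x b)))"
  have orth: "(\<Sum>a<m. cnj (V i a) * res x a) = 0" if "i < k" for i x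
  proof -
    have "(\<Sum>a<m. cnj (V i a) * (\<Sum>l<k. V l a * (\<Sum>b<m. cnj (V l b) * x b)))
        = (\<Sum>l<k. (\<Sum>a<m. cnj (V i a) * V l a) * (\<Sum>b<m. cnj (V l b) * x b))"
      by (simp only: sum_distrib_left[of _ _ "{..<k}"] sum_distrib_right[of _ "{..<m}"] mult.assoc) (rule sum.swap)
    also have "\<dots> = (\<Sum>l<k. if i = l then (\<Sum>b<m. cnj (V l b) * x b) else 0)"
      using that by (intro sum.cong) (auto simp: on)
    also have "\<dots> = (\<Sum>b<m. cnj (V i b) * x b)" using that by simp
    finally show ?thesis by (simp add: res_def right_diff_distrib sum_subtractf)
  qed
  have normalise: "\<exists>w c. (\<Sum>a<m. cnj (w a) * w a) = 1 \<and> (\<forall>i<k. (\<Sum>a<m. cnj (V i a) * w a) = 0)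
      \<and> (\<forall>a<m. res x a = c * w a)" if "b < m" "res x b \<noteq> 0" for x b
  proof -
    define n where "n = (\<Sum>a<m. (cmod (res x a))\<^sup>2)"
    have n: "n > 0" unfolding n_def using that by (intro sum_pos2[of _ b]) auto
    define w where "w = (\<lambda>a. res x a / of_real (sqrt n))"
    have "cnj (w a) * w a = of_real ((cmod (res x a))\<^sup>2 / n)" for a
      using n by (simp add: w_def complex_norm_square[symmetric] mult.commute flip: of_real_mult of_real_power)
    then have "(\<Sum>a<m. cnj (w a) * w a) = of_real (\<Sum>a<m. (cmod (res x a))\<^sup>2 / n)" by simp
    also have "\<dots> = 1" using n by (simp only: n_def flip: sum_divide_distrib) simp
    finally have 1: "(\<Sum>a<m. cnj (w a) * w a) = 1" .
    have 2: "(\<Sum>a<m. cnj (V i a) * w a) = 0" if "i < k" for i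
      using orth[OF that, of x] by (simp add: w_def flip: sum_divide_distrib)
    have "res x a = of_real (sqrt n) * w a" for a using n by (simp add: w_def)
    then show ?thesis using 1 2 by blast
  qed
  have x: "x a = (\<Sum>l<k. V l a * (\<Sum>b<m. cnj (V l b) * x b)) + z" if "res x a = z" for a z
    using that unfolding res_def by (simp add: diff_eq_eq add.commute)
  show ?thesis
  proof (cases "\<exists>b<m. res x b \<noteq> 0")
    case True
    then obtain w c where "(\<Sum>a<m. cnj (w a) * w a) = 1" "\<forall>i<k. (\<Sum>a<m. cnj (V i a) * w a) = 0"
      "\<forall>a<m. res x a = c * w a" using normalise by blast
    then show ?thesis by (intro that[of w c] x) auto
  next
    case False
    \<comment> \<open>If every standard basis vector were in the span, summing the squared moduli of all entries of
      the frame by rows and by columns would give \<open>m = k\<close>.\<close>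
    define e where "e = (\<lambda>(i::nat) a. if a = i then 1 else 0 :: complex)"
    have "\<exists>i<m. \<exists>b<m. res (e i) b \<noteq> 0"
    proof (rule ccontr)
      assume "\<not> ?thesis"
      then have "res (e i) i = 0" if "i < m" for i using that by blast
      then have "1 = (\<Sum>l<k. V l i * cnj (V l i))" if "i < m" for i
        using that by (simp add: res_def e_def if_distrib cong: if_cong)
      then have "of_nat m = (\<Sum>i<m. \<Sum>l<k. V l i * cnj (V l i))" by simp
      also have "\<dots> = (\<Sum>l<k. \<Sum>i<m. cnj (V l i) * V l i)"
        by (subst sum.swap) (simp add: mult.commute)
      also have "\<dots> = of_nat k" by (simp add: on)
      finally show False using km of_nat_eq_iff[where 'a = complex] by force
    qed
    then obtain w where "(\<Sum>a<m. cnj (w a) * w a) = 1" "\<forall>i<k. (\<Sum>a<m. cnj (V i a) * w a) = 0"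
      using normalise by blast
    then show ?thesis using False by (intro that[of w 0] x) auto
  qed
qed

text \<open>A QR factorisation, built column by column with \<open>R\<close> upper triangular. The
  frame has \<open>k\<close> members whatever the rank of the vectors \<open>y i\<close>.\<close>

lemma orthonormal_frame_spanning:
  fixes y :: "nat \<Rightarrow> nat \<Rightarrow> complex"
  assumes "k \<le> m"
  shows "\<exists>V R. (\<forall>i<k. \<forall>j<k. (\<Sum>a<m. cnj (V i a) * V j a) = (if i = j then 1 else 0)) \<and>
    (\<forall>i<k. \<forall>a<m. y i a = (\<Sum>l<k. V l a * R l i))"
  using assms
proof (induction k)
  case 0
  then show ?case by simp
next
  case (Suc k)
  then have "k \<le> m" by simp
  from Suc.IH[OF this] obtain V R
    where "\<forall>i<k. \<forall>j<k. (\<Sum>a<m. cnj (V i a) * V j a) = (if i = j then 1 else 0)"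
      and "\<forall>i<k. \<forall>a<m. y i a = (\<Sum>l<k. V l a * R l i)" by blast
  then have on: "\<And>i j. i < k \<Longrightarrow> j < k \<Longrightarrow> (\<Sum>a<m. cnj (V i a) * V j a) = (if i = j then 1 else 0)"
    and R: "\<And>i a. i < k \<Longrightarrow> a < m \<Longrightarrow> y i a = (\<Sum>l<k. V l a * R l i)" by blast+
  obtain w c where w: "(\<Sum>a<m. cnj (w a) * w a) = 1"
    "\<And>i. i < k \<Longrightarrow> (\<Sum>a<m. cnj (V i a) * w a) = 0"
    "\<And>a. a < m \<Longrightarrow> y k a = (\<Sum>l<k. V l a * (\<Sum>b<m. cnj (V l b) * y k b)) + c * w a"
    using orthonormal_extend[of k m V "y k"] on Suc.prems by auto
  have w': "(\<Sum>a<m. cnj (w a) * V i a) = 0" if "i < k" for i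
    using arg_cong[OF w(2)[OF that], of cnj] by (simp add: mult.commute)
  define V' where "V' = V(k := w)"
  define R' where "R' = (\<lambda>l i. if i = k then if l = k then c else (\<Sum>b<m. cnj (V l b) * y k b)
    else if l = k then 0 else R l i)"
  have "(\<Sum>a<m. cnj (V' i a) * V' j a) = (if i = j then 1 else 0)" if "i < Suc k" "j < Suc k" for i j
    using that on w w' by (auto simp: V'_def less_Suc_eq)
  moreover have "y i a = (\<Sum>l<Suc k. V' l a * R' l i)" if "i < Suc k" "a < m" for i a
    using that R[of i a] w(3)[of a] by (auto simp: V'_def R'_def less_Suc_eq mult.commute)
  ultimately show ?case by blast
qed

section \<open>Hermitian forms and the largest eigenvalue\<close>

text \<open>Kernels and vectors are plain functions, of which only the values below \<open>N\<close>
  count. Rank-one sums then become ordinary sums, and the product topology supplies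
  compactness.\<close>

definition herm_form :: "nat \<Rightarrow> (nat \<Rightarrow> nat \<Rightarrow> complex) \<Rightarrow> (nat \<Rightarrow> complex) \<Rightarrow> complex" where
  "herm_form N a y = (\<Sum>i<N. \<Sum>j<N. cnj (y i) * a i j * y j)"

lemma herm_form_cong:
  assumes "\<And>i j. i < N \<Longrightarrow> j < N \<Longrightarrow> a i j = b i j" and "\<And>i. i < N \<Longrightarrow> y i = z i"
  shows "herm_form N a y = herm_form N b z"
  unfolding herm_form_def using assms by (intro sum.cong refl) auto

lemma herm_form_rank_one:
  "herm_form N (\<lambda>i j. z i * cnj (z j)) y = of_real ((cmod (\<Sum>i<N. cnj (y i) * z i))\<^sup>2)"
proof -
  have "herm_form N (\<lambda>i j. z i * cnj (z j)) y
      = (\<Sum>i<N. cnj (y i) * z i) * cnj (\<Sum>i<N. cnj (y i) * z i)"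
    unfolding herm_form_def cnj_sum sum_product by (intro sum.cong refl) simp
  then show ?thesis by (simp only: complex_norm_square)
qed

lemma herm_form_add: "herm_form N (\<lambda>i j. a i j + b i j) y = herm_form N a y + herm_form N b y"
  by (simp add: herm_form_def algebra_simps sum.distrib)

lemma herm_form_scale: "herm_form N (\<lambda>i j. c * a i j) y = c * herm_form N a y"
  by (simp add: herm_form_def sum_distrib_left mult_ac)

lemma herm_form_sum: "herm_form N (\<lambda>i j. \<Sum>l\<in>T. a l i j) y = (\<Sum>l\<in>T. herm_form N (a l) y)"
proof -
  have "herm_form N (\<lambda>i j. \<Sum>l\<in>T. a l i j) y
      = (\<Sum>i<N. \<Sum>j<N. \<Sum>l\<in>T. cnj (y i) * a l i j * y j)"
    by (simp add: herm_form_def sum_distrib_left sum_distrib_right)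
  also have "\<dots> = (\<Sum>i<N. \<Sum>l\<in>T. \<Sum>j<N. cnj (y i) * a l i j * y j)"
    by (intro sum.cong refl sum.swap)
  also have "\<dots> = (\<Sum>l\<in>T. herm_form N (a l) y)"
    unfolding herm_form_def by (rule sum.swap)
  finally show ?thesis .
qed

lemma herm_form_identity:
  "herm_form N (\<lambda>i j. if i = j then c else 0) y = c * of_real (\<Sum>i<N. (cmod (y i))\<^sup>2)"
proof -
  have "herm_form N (\<lambda>i j. if i = j then c else 0) y = (\<Sum>i<N. \<Sum>j<N. if i = j then c * (y i * cnj (y i)) else 0)"
    unfolding herm_form_def by (intro sum.cong refl) simp
  also have "\<dots> = c * of_real (\<Sum>i<N. (cmod (y i))\<^sup>2)"
    by (simp add: sum_distrib_left complex_norm_square del: of_real_power)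
  finally show ?thesis .
qed

section \<open>Matrices read through their entries\<close>

lemma herm_form_mat:
  assumes "A \<in> carrier_mat N N" and "v \<in> carrier_vec N"
  shows "(A *\<^sub>v v) \<bullet>c v = herm_form N (\<lambda>i j. A $$ (i, j)) (vec_index v)"
  using assms unfolding herm_form_def
  by (auto simp: scalar_prod_def atLeast0LessThan sum_distrib_left mult_ac intro!: sum.cong)

lemma mat_adjoint_carrier [simp]: "A \<in> carrier_mat r c \<Longrightarrow> mat_adjoint A \<in> carrier_mat c r"
  by (auto simp: mat_adjoint_def)

lemma index_mat_adjoint:
  fixes A :: "complex mat"
  assumes "A \<in> carrier_mat r c" "i < c" "j < r"
  shows "mat_adjoint A $$ (i, j) = cnj (A $$ (j, i))"
  using assms by (auto simp: mat_adjoint_def mat_of_rows_index)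

lemma index_mult_mat_sum:
  assumes "A \<in> carrier_mat r c" "B \<in> carrier_mat c d" "i < r" "j < d"
  shows "(A * B) $$ (i, j) = (\<Sum>t<c. A $$ (i, t) * B $$ (t, j))"
  using assms by (auto simp: scalar_prod_def atLeast0LessThan)

lemma mat_adjoint_eq_iff:
  fixes A :: "complex mat"
  assumes "A \<in> carrier_mat N N"
  shows "mat_adjoint A = A \<longleftrightarrow> (\<forall>i<N. \<forall>j<N. A $$ (j, i) = cnj (A $$ (i, j)))"
proof
  assume "mat_adjoint A = A"
  then show "\<forall>i<N. \<forall>j<N. A $$ (j, i) = cnj (A $$ (i, j))"
    using index_mat_adjoint[OF assms] by metis
next
  assume "\<forall>i<N. \<forall>j<N. A $$ (j, i) = cnj (A $$ (i, j))"
  then have "mat_adjoint A $$ (i, j) = A $$ (i, j)" if "i < N" "j < N" for i j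
    using that index_mat_adjoint[OF assms] by metis
  then show "mat_adjoint A = A"
    using carrier_matD[OF assms] carrier_matD[OF mat_adjoint_carrier[OF assms]]
    by (intro eq_matI) auto
qed

lemma positive_semidefinite_iff:
  "positive_semidefinite N A \<longleftrightarrow> A \<in> carrier_mat N N \<and> (\<forall>i<N. \<forall>j<N. A $$ (j, i) = cnj (A $$ (i, j)))
     \<and> (\<forall>y. 0 \<le> Re (herm_form N (\<lambda>i j. A $$ (i, j)) y))"
proof (cases "A \<in> carrier_mat N N")
  case True
  have "herm_form N (\<lambda>i j. A $$ (i, j)) y = (A *\<^sub>v vec N y) \<bullet>c vec N y" for y
    unfolding herm_form_mat[OF True vec_carrier] by (intro herm_form_cong) auto
  then have "(\<forall>v\<in>carrier_vec N. 0 \<le> Re ((A *\<^sub>v v) \<bullet>c v))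
      \<longleftrightarrow> (\<forall>y. 0 \<le> Re (herm_form N (\<lambda>i j. A $$ (i, j)) y))"
    using herm_form_mat[OF True] by (metis vec_carrier)
  then show ?thesis using True by (simp add: positive_semidefinite_def mat_adjoint_eq_iff)
qed (simp add: positive_semidefinite_def)

text \<open>Tychonoff's theorem for a product of closed unit discs. Every coordinate has to be
  bounded, also those that a finite-dimensional problem never looks at.\<close>

lemma compact_bounded_functions: "compact {f :: 'i \<Rightarrow> complex. \<forall>i. cmod (f i) \<le> 1}"
proof -
  have "compactin (product_topology (\<lambda>i::'i. euclidean) UNIV) (PiE UNIV (\<lambda>_. cball (0::complex) 1))"
    by (simp add: compactin_PiE compact_cball)
  moreover have "PiE UNIV (\<lambda>_. cball (0::complex) 1) = {f :: 'i \<Rightarrow> complex. \<forall>i. cmod (f i) \<le> 1}"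
    by (auto simp: PiE_def Pi_def)
  ultimately show ?thesis by (simp add: euclidean_product_topology)
qed

lemma compact_unit_functions:
  "compact {u :: nat \<Rightarrow> complex. (\<forall>i. cmod (u i) \<le> 1) \<and> (\<Sum>i<N. (cmod (u i))\<^sup>2) = 1}"
proof -
  have "closed {u :: nat \<Rightarrow> complex. (\<Sum>i<N. (cmod (u i))\<^sup>2) = 1}"
    by (intro closed_Collect_eq continuous_intros continuous_on_product_coordinates)
  from compact_Int_closed[OF compact_bounded_functions this] show ?thesis
    by (simp add: Collect_conj_eq)
qed

text \<open>Makes the \<open>Max\<close> in \<open>lambda_max\<close> a genuine maximum.\<close>

lemma finite_eigenvalues:
  fixes A :: "complex mat"
  assumes "A \<in> carrier_mat N N"
  shows "finite {x. eigenvalue A x}"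
proof -
  have "char_poly A \<noteq> 0" using degree_monic_char_poly[OF assms] by auto
  then show ?thesis
    using poly_roots_finite[of "char_poly A"] by (simp add: eigenvalue_root_char_poly[OF assms])
qed

text \<open>Moves a unit vector with arbitrary values beyond \<open>N\<close> into the compact set
  of unit functions, keeping the coordinates that matter.\<close>

lemma truncate_unit:
  fixes u :: "nat \<Rightarrow> complex"
  assumes "(\<Sum>i<N. (cmod (u i))\<^sup>2) = 1"
  shows "\<exists>w. (\<forall>i<N. w i = u i) \<and> (\<forall>i. cmod (w i) \<le> 1) \<and> (\<Sum>i<N. (cmod (w i))\<^sup>2) = 1"
proof (intro exI conjI allI impI)
  define w where "w = (\<lambda>i. if i < N then u i else 0)"
  show w: "w i = u i" if "i < N" for i using that by (simp add: w_def)
  show "(\<Sum>i<N. (cmod (w i))\<^sup>2) = 1" using assms w by simp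
  show "cmod (w i) \<le> 1" for i
  proof (cases "i < N")
    case True
    then have "(cmod (u i))\<^sup>2 \<le> 1"
      unfolding assms[symmetric] by (intro member_le_sum[where f = "\<lambda>i. (cmod (u i))\<^sup>2"]) auto
    then show ?thesis using True abs_square_le_1[of "cmod (u i)"] by (simp add: w_def)
  qed (simp add: w_def)
qed

text \<open>A variational argument without diagonalisation. Let \<open>b\<close> be the maximum of
  the form on the unit sphere, attained at \<open>u\<close>. Then b I - H is positive semidefinite
  with a form vanishing at \<open>u\<close>, which forces H u = b u. Conversely, the form at an
  eigenvector bounds its eigenvalue by \<open>b\<close>.\<close>

lemma lambda_max_rayleigh:
  assumes H: "H \<in> carrier_mat N N" and N: "N > 0"
    and herm: "\<And>i j. i < N \<Longrightarrow> j < N \<Longrightarrow> H $$ (j, i) = cnj (H $$ (i, j))"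
  shows "\<exists>u. (\<Sum>i<N. (cmod (u i))\<^sup>2) = 1 \<and> Re (herm_form N (\<lambda>i j. H $$ (i, j)) u) = lambda_max H"
    and "Re (herm_form N (\<lambda>i j. H $$ (i, j)) v) \<le> lambda_max H * (\<Sum>i<N. (cmod (v i))\<^sup>2)"
proof -
  let ?h = "herm_form N (\<lambda>i j. H $$ (i, j))"
  define S where "S = {u :: nat \<Rightarrow> complex. (\<forall>i. cmod (u i) \<le> 1) \<and> (\<Sum>i<N. (cmod (u i))\<^sup>2) = 1}"
  have "(\<lambda>i. if i = 0 then 1 else 0) \<in> S"
    using N by (auto simp: S_def if_distrib[of "\<lambda>z. (cmod z)\<^sup>2"] cong: if_cong)
  then have "S \<noteq> {}" by blast
  moreover have "continuous_on S (\<lambda>u. Re (?h u))"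
    unfolding herm_form_def
    by (intro continuous_intros continuous_on_subset[OF continuous_on_product_coordinates]) auto
  moreover have "compact S" unfolding S_def by (rule compact_unit_functions)
  ultimately obtain u where u: "u \<in> S" and max: "\<And>w. w \<in> S \<Longrightarrow> Re (?h w) \<le> Re (?h u)"
    by (metis continuous_attains_sup)
  define b where "b = Re (?h u)"
  have u1: "(\<Sum>i<N. (cmod (u i))\<^sup>2) = 1" using u by (simp add: S_def)
  have bound: "Re (?h v) \<le> b * (\<Sum>i<N. (cmod (v i))\<^sup>2)" for v
  proof -
    define c where "c = (\<Sum>i<N. (cmod (v i))\<^sup>2)"
    have c0: "c \<ge> 0" unfolding c_def by (intro sum_nonneg) simp
    show ?thesis
    proof (cases "c = 0")
      case True
      then have "v i = 0" if "i < N" for i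
        using that by (simp add: c_def sum_nonneg_eq_0_iff)
      then have "?h v = 0" by (simp add: herm_form_def)
      then show ?thesis using True by (simp add: c_def)
    next
      case False
      define s where "s = of_real (inverse (sqrt c)) * (1::complex)"
      have s: "(cmod s)\<^sup>2 = inverse c"
        using c0 False by (simp add: s_def norm_inverse power_inverse)
      have "(\<Sum>i<N. (cmod (s * v i))\<^sup>2) = 1"
        using False by (simp add: norm_mult power_mult_distrib s c_def flip: sum_distrib_left)
      then obtain w where w: "\<And>i. i < N \<Longrightarrow> w i = s * v i" "w \<in> S"
        using truncate_unit[where N = N and u = "\<lambda>i. s * v i"] unfolding S_def by auto
      have "?h w = (cnj s * s) * ?h v"
        by (simp add: herm_form_def w sum_distrib_left mult_ac)
      also have "cnj s * s = of_real (inverse c)"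
        using complex_norm_square[of s] s by (simp add: mult.commute)
      finally have "Re (?h w) = inverse c * Re (?h v)" by (simp flip: of_real_inverse)
      then show ?thesis
        using mult_left_mono[OF max[OF w(2)] c0] False
        by (simp add: c_def[symmetric] b_def mult.commute[of _ c] flip: mult.assoc)
    qed
  qed
  define a where "a = (\<lambda>i j. (if i = j then of_real b else 0) + (-1) * H $$ (i, j))"
  have a_form: "herm_form N a v = of_real (b * (\<Sum>i<N. (cmod (v i))\<^sup>2)) - ?h v" for v
    unfolding a_def herm_form_add herm_form_scale herm_form_identity by simp
  have "\<exists>(L::nat) g. \<forall>i\<in>{..<N}. \<forall>j\<in>{..<N}. a i j = (\<Sum>l<L. g l i * cnj (g l j))"
  proof (rule psd_kernel_rank_one_sum)
    show "a j i = cnj (a i j)" if "i \<in> {..<N}" "j \<in> {..<N}" for i j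
      using herm[of i j] that by (simp add: a_def)
    show "0 \<le> Re (\<Sum>i<N. \<Sum>j<N. cnj (v i) * a i j * v j)" for v
      using bound[of v] a_form[of v] by (simp add: herm_form_def)
  qed simp
  then obtain L g where g: "\<And>i j. i < N \<Longrightarrow> j < N \<Longrightarrow> a i j = (\<Sum>l<L::nat. g l i * cnj (g l j))"
    by auto
  \<comment> \<open>As a sum of squares, the form of b I - H vanishes at \<open>u\<close> only if
    \<open>u\<close> is orthogonal to every factor \<open>g l\<close>; the kernel \<open>a\<close>
    then annihilates \<open>u\<close>.\<close>
  have "herm_form N a u = (\<Sum>l<L. of_real ((cmod (\<Sum>i<N. cnj (u i) * g l i))\<^sup>2))"
    unfolding herm_form_rank_one[symmetric] herm_form_sum[symmetric] by (intro herm_form_cong g) auto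
  moreover have "Re (herm_form N a u) = 0" unfolding a_form u1 b_def by simp
  ultimately have "(\<Sum>l<L. (cmod (\<Sum>i<N. cnj (u i) * g l i))\<^sup>2) = 0"
    by (simp flip: of_real_sum)
  then have gu: "(\<Sum>i<N. cnj (u i) * g l i) = 0" if "l < L" for l
    using that by (simp add: sum_nonneg_eq_0_iff)
  have au: "(\<Sum>j<N. a i j * u j) = 0" if "i < N" for i
  proof -
    have "(\<Sum>j<N. a i j * u j) = (\<Sum>j<N. \<Sum>l<L. g l i * cnj (cnj (u j) * g l j))"
      using that by (intro sum.cong) (simp_all add: g sum_distrib_left mult_ac)
    also have "\<dots> = (\<Sum>l<L. g l i * cnj (\<Sum>j<N. cnj (u j) * g l j))"
      by (subst sum.swap) (simp add: sum_distrib_left)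
    also have "\<dots> = 0" by (simp add: gu del: cnj_sum)
    finally show ?thesis .
  qed
  have Hu: "(\<Sum>j<N. H $$ (i, j) * u j) = of_real b * u i" if "i < N" for i
  proof -
    have "(\<Sum>j<N. a i j * u j) = of_real b * u i - (\<Sum>j<N. H $$ (i, j) * u j)"
    proof -
      have "a i j * u j = (if i = j then of_real b * u j else 0) - H $$ (i, j) * u j" for j
        by (simp add: a_def algebra_simps)
      then show ?thesis using that by (simp add: sum_subtractf)
    qed
    then show ?thesis using au[OF that] by simp
  qed
  have "eigenvector H (vec N u) (of_real b)"
    unfolding eigenvector_def
  proof (intro conjI)
    show "vec N u \<in> carrier_vec (dim_row H)" using H by simp
    show "vec N u \<noteq> 0\<^sub>v (dim_row H)"
    proof
      assume "vec N u = 0\<^sub>v (dim_row H)"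
      then have "u i = 0" if "i < N" for i
        using that H by (metis carrier_matD(1) index_vec index_zero_vec(1))
      then show False using u1 by simp
    qed
    show "H *\<^sub>v vec N u = complex_of_real b \<cdot>\<^sub>v vec N u"
      using H Hu by (intro eq_vecI) (auto simp: scalar_prod_def atLeast0LessThan)
  qed
  then have ev: "eigenvalue H (of_real b)" by (auto simp: eigenvalue_def)
  have le: "x \<le> b" if x: "eigenvalue H (of_real x)" for x
  proof -
    obtain v where v: "v \<in> carrier_vec N" "v \<noteq> 0\<^sub>v N" "H *\<^sub>v v = of_real x \<cdot>\<^sub>v v"
      using x H by (auto simp: eigenvalue_def eigenvector_def)
    define c where "c = (\<Sum>i<N. (cmod (vec_index v i))\<^sup>2)"
    have "?h (vec_index v) = of_real x * (\<Sum>i<N. vec_index v i * cnj (vec_index v i))"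
      using v by (simp add: herm_form_mat[OF H, symmetric] scalar_prod_def atLeast0LessThan
          sum_distrib_left mult_ac)
    also have "(\<Sum>i<N. vec_index v i * cnj (vec_index v i)) = of_real c"
      by (simp add: c_def complex_norm_square del: of_real_power)
    finally have "x * c \<le> b * c" using bound[of "vec_index v"] by (simp add: c_def)
    moreover have "c > 0"
    proof -
      obtain i where "i < N" "vec_index v i \<noteq> 0" using v by (metis carrier_vecD eq_vecI index_zero_vec)
      then show ?thesis unfolding c_def by (intro sum_pos2[of _ i]) auto
    qed
    ultimately show ?thesis by simp
  qed
  have "finite {x. eigenvalue H (complex_of_real x)}"
    using finite_vimageI[OF finite_eigenvalues[OF H] inj_of_real] by (simp add: vimage_def)
  then have "lambda_max H = b"
    unfolding lambda_max_def by (intro Max_eqI) (use ev le in auto)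
  then show "\<exists>u. (\<Sum>i<N. (cmod (u i))\<^sup>2) = 1 \<and> Re (?h u) = lambda_max H"
    and "Re (?h v) \<le> lambda_max H * (\<Sum>i<N. (cmod (v i))\<^sup>2)"
    using u1 bound b_def by auto
qed

section \<open>Compressions by isometries\<close>

text \<open>This is the squared norm of Z^* vec(W), that is, the quadratic form of Z Z^* at
  vec(W).\<close>

definition overlap :: "nat \<Rightarrow> nat \<Rightarrow> nat \<Rightarrow> (nat \<Rightarrow> complex mat) \<Rightarrow> (nat \<Rightarrow> nat \<Rightarrow> complex) \<Rightarrow> real" where
  "overlap m n q B W = (\<Sum>s<q. (cmod (\<Sum>j<n. \<Sum>a<m. cnj (B s $$ (a, j)) * W a j))\<^sup>2)"

definition frob_sq :: "nat \<Rightarrow> nat \<Rightarrow> (nat \<Rightarrow> nat \<Rightarrow> complex) \<Rightarrow> real" where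
  "frob_sq m n W = (\<Sum>j<n. \<Sum>a<m. (cmod (W a j))\<^sup>2)"

text \<open>The product of the matrix with columns \<open>V 0, \<dots>, V (k - 1)\<close> and the \<open>k\<close>-row matrix whose column
  stacking is \<open>u\<close>.\<close>
definition frame_prod :: "nat \<Rightarrow> (nat \<Rightarrow> nat \<Rightarrow> complex) \<Rightarrow> (nat \<Rightarrow> complex) \<Rightarrow> nat \<Rightarrow> nat \<Rightarrow> complex" where
  "frame_prod k V u a j = (\<Sum>i<k. V i a * u (j * k + i))"

text \<open>The column index comes first: \<open>V i a\<close> corresponds to the matrix entry
  \<open>V $$ (a, i)\<close>.\<close>

definition orthonormal_frame :: "nat \<Rightarrow> nat \<Rightarrow> (nat \<Rightarrow> nat \<Rightarrow> complex) \<Rightarrow> bool" where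
  "orthonormal_frame m k V \<longleftrightarrow>
     (\<forall>i<k. \<forall>j<k. (\<Sum>a<m. cnj (V i a) * V j a) = (if i = j then 1 else 0))"

lemma overlap_cong:
  assumes "\<And>a j. a < m \<Longrightarrow> j < n \<Longrightarrow> W a j = W' a j"
  shows "overlap m n q B W = overlap m n q B W'"
  unfolding overlap_def using assms by (intro sum.cong refl arg_cong[where f = "\<lambda>z. (cmod z)\<^sup>2"]) auto

lemma frob_sq_cong:
  assumes "\<And>a j. a < m \<Longrightarrow> j < n \<Longrightarrow> W a j = W' a j"
  shows "frob_sq m n W = frob_sq m n W'"
  unfolding frob_sq_def using assms by (intro sum.cong refl) auto

text \<open>An isometry preserves the norm of each column. Normalising the product V U therefore
  means normalising \<open>u\<close>, independently of the frame.\<close>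

lemma frob_sq_frame_prod:
  assumes "orthonormal_frame m k V"
  shows "frob_sq m n (frame_prod k V u) = (\<Sum>r<n*k. (cmod (u r))\<^sup>2)"
proof -
  have "(\<Sum>a<m. (cmod (frame_prod k V u a j))\<^sup>2) = (\<Sum>i<k. (cmod (u (j * k + i)))\<^sup>2)" for j
  proof -
    let ?w = "\<lambda>i. u (j * k + i)"
    have "of_real (\<Sum>a<m. (cmod (frame_prod k V u a j))\<^sup>2)
        = (\<Sum>a<m. (\<Sum>l<k. V l a * ?w l) * cnj (\<Sum>i<k. V i a * ?w i))"
      by (simp add: frame_prod_def complex_norm_square del: of_real_power cnj_sum)
    also have "\<dots> = (\<Sum>a<m. \<Sum>l<k. \<Sum>i<k. ?w l * cnj (?w i) * (cnj (V i a) * V l a))"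
      unfolding cnj_sum sum_product by (intro sum.cong refl) simp
    also have "\<dots> = (\<Sum>l<k. \<Sum>a<m. \<Sum>i<k. ?w l * cnj (?w i) * (cnj (V i a) * V l a))"
      by (rule sum.swap)
    also have "\<dots> = (\<Sum>l<k. \<Sum>i<k. \<Sum>a<m. ?w l * cnj (?w i) * (cnj (V i a) * V l a))"
      by (intro sum.cong refl sum.swap)
    also have "\<dots> = (\<Sum>l<k. \<Sum>i<k. if l = i then ?w l * cnj (?w i) else 0)"
      using assms by (intro sum.cong refl) (auto simp: orthonormal_frame_def simp flip: sum_distrib_left)
    also have "\<dots> = of_real (\<Sum>i<k. (cmod (?w i))\<^sup>2)"
      by (simp add: complex_norm_square del: of_real_power)
    finally show ?thesis by (simp only: of_real_eq_iff)
  qed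
  then have "frob_sq m n (frame_prod k V u) = (\<Sum>j<n. \<Sum>i<k. (cmod (u (j * k + i)))\<^sup>2)"
    by (simp add: frob_sq_def)
  also have "\<dots> = (\<Sum>r<n*k. (cmod (u r))\<^sup>2)"
    using sum_div_mod[of "\<lambda>j i. (cmod (u (j * k + i)))\<^sup>2" k n] by simp
  finally show ?thesis .
qed

definition compression :: "real \<Rightarrow> nat \<Rightarrow> nat \<Rightarrow> nat \<Rightarrow> (nat \<Rightarrow> complex mat) \<Rightarrow> complex mat \<Rightarrow> complex mat" where
  "compression \<sigma> m n q B V = mat_adjoint (kronecker (1\<^sub>m n) V)
     * (complex_of_real (- \<sigma>) \<cdot>\<^sub>m (Z_mat m n q B * mat_adjoint (Z_mat m n q B)))
     * kronecker (1\<^sub>m n) V"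

lemma kronecker_one_carrier [simp]:
  assumes "V \<in> carrier_mat m k"
  shows "kronecker (1\<^sub>m n) V \<in> carrier_mat (n * m) (n * k)"
  using assms by (auto simp: kronecker_def)

lemma kronecker_one_apply:
  assumes "V \<in> carrier_mat m k" and "t < n * m"
  shows "(\<Sum>r<n*k. kronecker (1\<^sub>m n) V $$ (t, r) * u r)
    = frame_prod k (\<lambda>i a. V $$ (a, i)) u (t mod m) (t div m)"
proof -
  have t: "t div m < n" using assms(2) by (simp add: less_mult_imp_div_less)
  have "(\<Sum>r<n*k. kronecker (1\<^sub>m n) V $$ (t, r) * u r)
      = (\<Sum>r<n*k. (if t div m = r div k then V $$ (t mod m, r mod k) * u (r div k * k + r mod k) else 0))"
    using assms t by (intro sum.cong) (auto simp: kronecker_def less_mult_imp_div_less)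
  also have "\<dots> = (\<Sum>p<n. \<Sum>i<k. if t div m = p then V $$ (t mod m, i) * u (p * k + i) else 0)"
    by (rule sum_div_mod[of "\<lambda>p i. if t div m = p then V $$ (t mod m, i) * u (p * k + i) else 0"])
  also have "\<dots> = (\<Sum>p<n. if t div m = p then (\<Sum>i<k. V $$ (t mod m, i) * u (p * k + i)) else 0)"
    by (intro sum.cong) auto
  also have "\<dots> = frame_prod k (\<lambda>i a. V $$ (a, i)) u (t mod m) (t div m)"
    using t by (simp add: frame_prod_def)
  finally show ?thesis .
qed

lemma Z_mat_carrier [simp]: "Z_mat m n q B \<in> carrier_mat (m * n) q"
  by (auto simp: Z_mat_def)

lemma index_Z_mat:
  assumes "B s \<in> carrier_mat m n" "s < q" "t < m * n"
  shows "Z_mat m n q B $$ (t, s) = B s $$ (t mod m, t div m)"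
  using assms by (auto simp: Z_mat_def mat_of_cols_index vectorize_def)

text \<open>With K the Kronecker factor, the compression is \<open>- \<sigma>\<close> times the Gram
  matrix of Z^* K, whose row \<open>s\<close> is \<open>P s\<close>. It is thus a real multiple of a
  sum of rank-one kernels, from which both the symmetry and the form can be read off.\<close>

lemma
  assumes V: "V \<in> carrier_mat m k" and B: "\<forall>s<q. B s \<in> carrier_mat m n"
  shows compression_carrier: "compression \<sigma> m n q B V \<in> carrier_mat (n * k) (n * k)"
    and compression_hermitian: "\<And>i j. i < n * k \<Longrightarrow> j < n * k \<Longrightarrow>
        compression \<sigma> m n q B V $$ (j, i) = cnj (compression \<sigma> m n q B V $$ (i, j))"
    and herm_form_compression: "herm_form (n * k) (\<lambda>i j. compression \<sigma> m n q B V $$ (i, j)) u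
        = of_real (- \<sigma> * overlap m n q B (frame_prod k (\<lambda>i a. V $$ (a, i)) u))"
proof -
  let ?K = "kronecker (1\<^sub>m n) V" and ?Z = "Z_mat m n q B"
  have K: "?K \<in> carrier_mat (n * m) (n * k)" using V by simp
  have Z: "?Z \<in> carrier_mat (n * m) q" using Z_mat_carrier[of m n q B] by (simp add: mult.commute)
  note KA = mat_adjoint_carrier[OF K] and ZA = mat_adjoint_carrier[OF Z]
  define P where "P = (\<lambda>s i. \<Sum>t<n*m. cnj (?Z $$ (t, s)) * ?K $$ (t, i))"
  define M where "M = ?Z * mat_adjoint ?Z"
  have M: "M \<in> carrier_mat (n * m) (n * m)" unfolding M_def using Z ZA by auto
  have Mi: "M $$ (t, t') = (\<Sum>s<q. ?Z $$ (t, s) * cnj (?Z $$ (t', s)))" if "t < n * m" "t' < n * m" for t t'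
    using that unfolding M_def by (simp add: index_mult_mat_sum[OF Z ZA] index_mat_adjoint[OF Z])
  show C: "compression \<sigma> m n q B V \<in> carrier_mat (n * k) (n * k)"
    unfolding compression_def M_def[symmetric]
    by (rule mult_carrier_mat[OF mult_carrier_mat[OF KA smult_carrier_mat[OF M]] K])
  \<comment> \<open>The double conjugate gives each summand the shape \<open>z i * cnj (z j)\<close>
    of \<open>herm_form_rank_one\<close>, with \<open>z i = cnj (P s i)\<close>.\<close>
  have entry: "compression \<sigma> m n q B V $$ (i, j) = of_real (- \<sigma>) * (\<Sum>s<q. cnj (P s i) * cnj (cnj (P s j)))"
    if "i < n * k" "j < n * k" for i j
  proof -
    have "compression \<sigma> m n q B V $$ (i, j)
        = (\<Sum>t'<n*m. (\<Sum>t<n*m. cnj (?K $$ (t, i)) * (of_real (- \<sigma>) * M $$ (t, t'))) * ?K $$ (t', j))"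
    proof -
      have N: "of_real (- \<sigma>) \<cdot>\<^sub>m M \<in> carrier_mat (n * m) (n * m)" using M by simp
      show ?thesis
        unfolding compression_def M_def[symmetric] using that M
        by (simp add: index_mult_mat_sum[OF mult_carrier_mat[OF KA N] K] index_mult_mat_sum[OF KA N]
            index_mat_adjoint[OF K] del: of_real_minus index_mult_mat)
    qed
    also have "\<dots> = (\<Sum>t'<n*m. \<Sum>t<n*m. \<Sum>s<q. of_real (- \<sigma>) *
        ((?Z $$ (t, s) * cnj (?K $$ (t, i))) * (cnj (?Z $$ (t', s)) * ?K $$ (t', j))))"
      unfolding sum_distrib_right by (intro sum.cong refl) (simp add: Mi sum_distrib_left sum_distrib_right mult_ac)
    also have "\<dots> = (\<Sum>t'<n*m. \<Sum>s<q. \<Sum>t<n*m. of_real (- \<sigma>) *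
        ((?Z $$ (t, s) * cnj (?K $$ (t, i))) * (cnj (?Z $$ (t', s)) * ?K $$ (t', j))))"
      by (intro sum.cong refl sum.swap)
    also have "\<dots> = (\<Sum>s<q. \<Sum>t'<n*m. \<Sum>t<n*m. of_real (- \<sigma>) *
        ((?Z $$ (t, s) * cnj (?K $$ (t, i))) * (cnj (?Z $$ (t', s)) * ?K $$ (t', j))))"
      by (rule sum.swap)
    also have "\<dots> = (\<Sum>s<q. of_real (- \<sigma>) * (cnj (P s i) * P s j))"
    proof (intro sum.cong refl)
      fix s
      have "cnj (P s i) * P s j = (\<Sum>t<n*m. \<Sum>t'<n*m.
          (?Z $$ (t, s) * cnj (?K $$ (t, i))) * (cnj (?Z $$ (t', s)) * ?K $$ (t', j)))"
        unfolding P_def cnj_sum sum_product by simp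
      also have "\<dots> = (\<Sum>t'<n*m. \<Sum>t<n*m.
          (?Z $$ (t, s) * cnj (?K $$ (t, i))) * (cnj (?Z $$ (t', s)) * ?K $$ (t', j)))"
        by (rule sum.swap)
      finally show "(\<Sum>t'<n*m. \<Sum>t<n*m. of_real (- \<sigma>) *
          ((?Z $$ (t, s) * cnj (?K $$ (t, i))) * (cnj (?Z $$ (t', s)) * ?K $$ (t', j))))
        = of_real (- \<sigma>) * (cnj (P s i) * P s j)"
        by (simp only: sum_distrib_left)
    qed
    finally show ?thesis by (simp add: sum_distrib_left)
  qed
  show "compression \<sigma> m n q B V $$ (j, i) = cnj (compression \<sigma> m n q B V $$ (i, j))"
    if "i < n * k" "j < n * k" for i j
    using that by (simp add: entry mult.commute)
  have P: "(\<Sum>i<n*k. P s i * u i) = (\<Sum>j<n. \<Sum>a<m. cnj (B s $$ (a, j)) * frame_prod k (\<lambda>i a. V $$ (a, i)) u a j)"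
    if s: "s < q" for s
  proof -
    have "(\<Sum>i<n*k. P s i * u i) = (\<Sum>i<n*k. \<Sum>t<n*m. cnj (?Z $$ (t, s)) * (?K $$ (t, i) * u i))"
      by (simp add: P_def sum_distrib_right mult.assoc)
    also have "\<dots> = (\<Sum>t<n*m. cnj (?Z $$ (t, s)) * (\<Sum>i<n*k. ?K $$ (t, i) * u i))"
      by (subst sum.swap) (simp add: sum_distrib_left)
    also have "\<dots> = (\<Sum>t<n*m. cnj (B s $$ (t mod m, t div m)) * frame_prod k (\<lambda>i a. V $$ (a, i)) u (t mod m) (t div m))"
      by (intro sum.cong refl) (simp add: kronecker_one_apply[OF V] index_Z_mat[where B = B, OF B[rule_format, OF s] s] mult.commute[of n m])
    also have "\<dots> = (\<Sum>j<n. \<Sum>a<m. cnj (B s $$ (a, j)) * frame_prod k (\<lambda>i a. V $$ (a, i)) u a j)"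
      by (rule sum_div_mod[of "\<lambda>j a. cnj (B s $$ (a, j)) * frame_prod k (\<lambda>i a. V $$ (a, i)) u a j"])
    finally show ?thesis .
  qed
  have cP: "(\<Sum>i<n*k. cnj (u i) * cnj (P s i)) = cnj (\<Sum>i<n*k. P s i * u i)" for s
    by (simp add: mult.commute)
  have "herm_form (n * k) (\<lambda>i j. compression \<sigma> m n q B V $$ (i, j)) u
      = herm_form (n * k) (\<lambda>i j. of_real (- \<sigma>) * (\<Sum>s<q. cnj (P s i) * cnj (cnj (P s j)))) u"
    by (intro herm_form_cong entry refl)
  also have "\<dots> = of_real (- \<sigma>) * (\<Sum>s<q. of_real ((cmod (\<Sum>i<n*k. cnj (u i) * cnj (P s i)))\<^sup>2))"
    unfolding herm_form_scale herm_form_sum herm_form_rank_one ..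
  finally show "herm_form (n * k) (\<lambda>i j. compression \<sigma> m n q B V $$ (i, j)) u
        = of_real (- \<sigma> * overlap m n q B (frame_prod k (\<lambda>i a. V $$ (a, i)) u))"
    unfolding overlap_def cP complex_mod_cnj by (simp add: P)
qed

lemma isometry_iff_orthonormal_frame:
  assumes "V \<in> carrier_mat m k"
  shows "mat_adjoint V * V = 1\<^sub>m k \<longleftrightarrow> orthonormal_frame m k (\<lambda>i a. V $$ (a, i))"
proof -
  note VA = mat_adjoint_carrier[OF assms]
  have e: "(mat_adjoint V * V) $$ (i, j) = (\<Sum>a<m. cnj (V $$ (a, i)) * V $$ (a, j))" if "i < k" "j < k" for i j
    using that by (simp add: index_mult_mat_sum[OF VA assms] index_mat_adjoint[OF assms])
  show ?thesis
  proof
    assume "mat_adjoint V * V = 1\<^sub>m k"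
    then show "orthonormal_frame m k (\<lambda>i a. V $$ (a, i))"
      unfolding orthonormal_frame_def using e by (metis index_one_mat(1))
  next
    assume "orthonormal_frame m k (\<lambda>i a. V $$ (a, i))"
    then have "(mat_adjoint V * V) $$ (i, j) = 1\<^sub>m k $$ (i, j)" if "i < k" "j < k" for i j
      using that unfolding e[OF that] by (simp add: orthonormal_frame_def)
    then show "mat_adjoint V * V = 1\<^sub>m k"
      using mult_carrier_mat[OF VA assms] by (intro eq_matI) (auto simp del: index_mult_mat)
  qed
qed

section \<open>The maximum over isometries\<close>

lemma beta_eq:
  "beta \<sigma> k m n q B = (GREATEST b. b \<in> {lambda_max (compression \<sigma> m n q B V)
      | V. V \<in> carrier_mat m k \<and> orthonormal_frame m k (\<lambda>i a. V $$ (a, i))})"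
  unfolding beta_def compression_def by (simp only: isometry_iff_orthonormal_frame cong: conj_cong)

lemma orthonormal_frame_bounded:
  assumes "orthonormal_frame m k V" "i < k" "a < m"
  shows "cmod (V i a) \<le> 1"
proof -
  have "of_real (\<Sum>a<m. (cmod (V i a))\<^sup>2) = (\<Sum>a<m. cnj (V i a) * V i a)"
    by (simp add: complex_norm_square mult.commute del: of_real_power)
  also have "\<dots> = of_real 1" using assms by (simp add: orthonormal_frame_def)
  finally have "(\<Sum>a<m. (cmod (V i a))\<^sup>2) = 1" by (simp only: of_real_eq_iff)
  moreover have "(cmod (V i a))\<^sup>2 \<le> (\<Sum>a<m. (cmod (V i a))\<^sup>2)"
    using assms by (intro member_le_sum) auto
  ultimately show ?thesis using abs_square_le_1[of "cmod (V i a)"] by simp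
qed

lemma orthonormal_frame_cong:
  assumes "\<And>i a. i < k \<Longrightarrow> a < m \<Longrightarrow> V i a = V' i a"
  shows "orthonormal_frame m k V \<longleftrightarrow> orthonormal_frame m k V'"
proof -
  have "(\<Sum>a<m. cnj (V i a) * V j a) = (\<Sum>a<m. cnj (V' i a) * V' j a)" if "i < k" "j < k" for i j
    using that assms by (intro sum.cong refl) auto
  then show ?thesis by (simp add: orthonormal_frame_def)
qed

text \<open>A frame is a single function on index pairs, so that Tychonoff applies directly;
  orthonormality consists of finitely many closed conditions on coordinates.\<close>

lemma compact_orthonormal_frames:
  "compact {v :: nat \<times> nat \<Rightarrow> complex. (\<forall>x. cmod (v x) \<le> 1) \<and> orthonormal_frame m k (curry v)}"
proof -
  have "{v. orthonormal_frame m k (curry v)} = (\<Inter>i<k. \<Inter>j<k.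
      {v :: nat \<times> nat \<Rightarrow> complex. (\<Sum>a<m. cnj (v (i, a)) * v (j, a)) = (if i = j then 1 else 0)})"
    by (auto simp: orthonormal_frame_def)
  also have "closed \<dots>"
    by (intro closed_INT ballI closed_Collect_eq continuous_intros continuous_on_product_coordinates)
  finally show ?thesis
    using compact_Int_closed[OF compact_bounded_functions] by (simp add: Collect_conj_eq del: split_paired_All)
qed

lemma frame_prod_cong:
  assumes "\<And>i. i < k \<Longrightarrow> V i a = V' i a" and "\<And>r. r < n * k \<Longrightarrow> u r = u' r" and "j < n"
  shows "frame_prod k V u a j = frame_prod k V' u' a j"
proof -
  have "j * k + i < n * k" if "i < k" for i
    using mult_le_mono1[of "Suc j" n k] that assms(3) by simp
  then show ?thesis unfolding frame_prod_def using assms by (intro sum.cong refl) auto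
qed

text \<open>The maximum is taken jointly over frames and unit vectors. This avoids proving that the
  largest eigenvalue depends continuously on the isometry. The constant \<open>c\<close> is later
  \<open>- \<sigma>\<close>.\<close>

lemma compact_optimum:
  assumes "k \<le> m" and "0 < n * k"
  obtains V u where "orthonormal_frame m k V" "(\<Sum>r<n*k. (cmod (u r))\<^sup>2) = 1"
    and "\<And>V' u'. orthonormal_frame m k V' \<Longrightarrow> (\<Sum>r<n*k. (cmod (u' r))\<^sup>2) = 1 \<Longrightarrow>
      c * overlap m n q B (frame_prod k V' u') \<le> c * overlap m n q B (frame_prod k V u)"
proof -
  define F where "F = {v :: nat \<times> nat \<Rightarrow> complex. (\<forall>x. cmod (v x) \<le> 1) \<and> orthonormal_frame m k (curry v)}"
  define U where "U = {u :: nat \<Rightarrow> complex. (\<forall>i. cmod (u i) \<le> 1) \<and> (\<Sum>r<n*k. (cmod (u r))\<^sup>2) = 1}"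
  let ?f = "\<lambda>p. c * overlap m n q B (frame_prod k (curry (fst p)) (snd p))"
  \<comment> \<open>The first \<open>k\<close> standard basis vectors form a frame because
    \<open>k <= m\<close>.\<close>
  have "(\<lambda>p. if fst p = snd p then 1 else 0) \<in> F"
    using assms(1) by (auto simp: F_def orthonormal_frame_def if_distrib[of cnj] if_distrib[of "\<lambda>z. z * _"] cong: if_cong)
  moreover have "(\<lambda>i. if i = 0 then 1 else 0) \<in> U"
    using assms(2) by (auto simp: U_def if_distrib[of "\<lambda>z. (cmod z)\<^sup>2"] cong: if_cong)
  ultimately have ne: "F \<times> U \<noteq> {}" by blast
  have compact: "compact (F \<times> U)"
    unfolding F_def U_def by (intro compact_Times compact_orthonormal_frames compact_unit_functions)
  have cont: "continuous_on (F \<times> U) ?f"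
    unfolding overlap_def frame_prod_def curry_def
    by (intro continuous_intros continuous_on_compose2[OF continuous_on_product_coordinates continuous_on_fst]
        continuous_on_compose2[OF continuous_on_product_coordinates continuous_on_snd]) auto
  obtain p where p: "p \<in> F \<times> U" and max: "\<And>p'. p' \<in> F \<times> U \<Longrightarrow> ?f p' \<le> ?f p"
    using continuous_attains_sup[OF compact ne cont] by blast
  show ?thesis
  proof (rule that[of "curry (fst p)" "snd p"])
    show "orthonormal_frame m k (curry (fst p))" "(\<Sum>r<n*k. (cmod (snd p r))\<^sup>2) = 1"
      using p by (auto simp: F_def U_def)
    fix V' u' assume V': "orthonormal_frame m k V'" and u': "(\<Sum>r<n*k. (cmod (u' r))\<^sup>2) = 1"
    \<comment> \<open>A competitor may take any values outside the index range; it is set to zero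
      there to enter the compact set.\<close>
    define v where "v = (\<lambda>(i, a). if i < k \<and> a < m then V' i a else 0)"
    have "orthonormal_frame m k (curry v)"
      using V' by (subst orthonormal_frame_cong[of k m _ V']) (auto simp: v_def)
    then have v: "v \<in> F" using orthonormal_frame_bounded[OF V'] by (auto simp: F_def v_def)
    obtain w where w: "\<forall>i<n * k. w i = u' i" "\<forall>i. cmod (w i) \<le> 1"
      "(\<Sum>r<n*k. (cmod (w r))\<^sup>2) = 1"
      using truncate_unit[OF u'] by blast
    then have wU: "w \<in> U" by (simp add: U_def)
    have "overlap m n q B (frame_prod k V' u') = overlap m n q B (frame_prod k (curry v) w)"
      by (intro overlap_cong frame_prod_cong) (simp_all add: v_def w(1))
    then show "c * overlap m n q B (frame_prod k V' u') \<le> c * overlap m n q B (frame_prod k (curry (fst p)) (snd p))"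
      using max[of "(v, w)"] v wU by simp
  qed
qed

text \<open>The joint optimum bounds every \<open>lambda_max\<close> in the set, since each of these
  is an attained Rayleigh quotient. It is also a Rayleigh quotient of the compression by its own
  frame, hence at most one of these values. So it belongs to the set, and \<open>GREATEST\<close> is
  well determined.\<close>

lemma
  assumes k: "1 \<le> k" "k \<le> m" and n: "1 \<le> n" and B: "\<forall>s<q. B s \<in> carrier_mat m n"
  shows beta_attained: "\<exists>V u. orthonormal_frame m k V \<and> (\<Sum>r<n*k. (cmod (u r))\<^sup>2) = 1 \<and>
      beta \<sigma> k m n q B = - \<sigma> * overlap m n q B (frame_prod k V u)"
    and beta_bound: "orthonormal_frame m k V' \<Longrightarrow>
      - \<sigma> * overlap m n q B (frame_prod k V' u') \<le> beta \<sigma> k m n q B * (\<Sum>r<n*k. (cmod (u' r))\<^sup>2)"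
proof -
  have nk: "0 < n * k" using k n by simp
  have to_mat: "\<exists>V. V \<in> carrier_mat m k \<and> orthonormal_frame m k (\<lambda>i a. V $$ (a, i)) \<and>
      (\<forall>u. overlap m n q B (frame_prod k (\<lambda>i a. V $$ (a, i)) u) = overlap m n q B (frame_prod k W u))"
    if "orthonormal_frame m k W" for W
  proof (intro exI conjI allI)
    let ?V = "mat m k (\<lambda>(a, i). W i a)"
    show "orthonormal_frame m k (\<lambda>i a. ?V $$ (a, i))"
      using that by (subst orthonormal_frame_cong[of k m _ W]) auto
    show "overlap m n q B (frame_prod k (\<lambda>i a. ?V $$ (a, i)) u) = overlap m n q B (frame_prod k W u)" for u
      by (intro overlap_cong frame_prod_cong) auto
  qed simp
  note comp = compression_carrier[OF _ B, where \<sigma> = \<sigma>]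
    and herm = compression_hermitian[OF _ B, where \<sigma> = \<sigma>]
    and form = herm_form_compression[OF _ B, where \<sigma> = \<sigma>]
  have bound: "- \<sigma> * overlap m n q B (frame_prod k (\<lambda>i a. V $$ (a, i)) u)
      \<le> lambda_max (compression \<sigma> m n q B V) * (\<Sum>r<n*k. (cmod (u r))\<^sup>2)"
    if "V \<in> carrier_mat m k" for V u
    using lambda_max_rayleigh(2)[OF comp[OF that] nk herm[OF that], of u]
    by (simp only: form[OF that] Re_complex_of_real)
  have attained: "\<exists>u. (\<Sum>r<n*k. (cmod (u r))\<^sup>2) = 1 \<and>
      - \<sigma> * overlap m n q B (frame_prod k (\<lambda>i a. V $$ (a, i)) u) = lambda_max (compression \<sigma> m n q B V)"
    if "V \<in> carrier_mat m k" for V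
    using lambda_max_rayleigh(1)[OF comp[OF that] nk herm[OF that]]
    by (simp only: form[OF that] Re_complex_of_real)
  obtain V u where V: "orthonormal_frame m k V" and u: "(\<Sum>r<n*k. (cmod (u r))\<^sup>2) = 1"
    and max: "\<And>V' u'. orthonormal_frame m k V' \<Longrightarrow> (\<Sum>r<n*k. (cmod (u' r))\<^sup>2) = 1 \<Longrightarrow>
      - \<sigma> * overlap m n q B (frame_prod k V' u') \<le> - \<sigma> * overlap m n q B (frame_prod k V u)"
    using compact_optimum[OF k(2) nk] by metis
  let ?S = "{lambda_max (compression \<sigma> m n q B V)
      | V. V \<in> carrier_mat m k \<and> orthonormal_frame m k (\<lambda>i a. V $$ (a, i))}"
  let ?b = "- \<sigma> * overlap m n q B (frame_prod k V u)"
  have le: "x \<le> ?b" if "x \<in> ?S" for x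
    using that attained max by force
  obtain Vm where Vm: "Vm \<in> carrier_mat m k" "orthonormal_frame m k (\<lambda>i a. Vm $$ (a, i))"
    "overlap m n q B (frame_prod k (\<lambda>i a. Vm $$ (a, i)) u) = overlap m n q B (frame_prod k V u)"
    using to_mat[OF V] by blast
  have "?b \<le> lambda_max (compression \<sigma> m n q B Vm)"
    using bound[OF Vm(1), of u] Vm(3) u by simp
  moreover have mem: "lambda_max (compression \<sigma> m n q B Vm) \<in> ?S" using Vm by blast
  ultimately have "?b \<in> ?S" using le[OF mem] by simp
  then have beta: "beta \<sigma> k m n q B = ?b"
    unfolding beta_eq by (rule Greatest_equality) (rule le)
  then show "\<exists>V u. orthonormal_frame m k V \<and> (\<Sum>r<n*k. (cmod (u r))\<^sup>2) = 1 \<and>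
      beta \<sigma> k m n q B = - \<sigma> * overlap m n q B (frame_prod k V u)"
    using V u by blast
  assume V': "orthonormal_frame m k V'"
  obtain Vn where Vn: "Vn \<in> carrier_mat m k" "orthonormal_frame m k (\<lambda>i a. Vn $$ (a, i))"
    "overlap m n q B (frame_prod k (\<lambda>i a. Vn $$ (a, i)) u') = overlap m n q B (frame_prod k V' u')"
    using to_mat[OF V'] by blast
  have "lambda_max (compression \<sigma> m n q B Vn) \<le> beta \<sigma> k m n q B"
    unfolding beta using Vn by (intro le) blast
  then show "- \<sigma> * overlap m n q B (frame_prod k V' u') \<le> beta \<sigma> k m n q B * (\<Sum>r<n*k. (cmod (u' r))\<^sup>2)"
    using bound[OF Vn(1), of u'] Vn(3)
      mult_right_mono[of "lambda_max (compression \<sigma> m n q B Vn)" "beta \<sigma> k m n q B" "\<Sum>r<n*k. (cmod (u' r))\<^sup>2"]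
    by (simp add: sum_nonneg)
qed

section \<open>Block positivity\<close>

lemma Phi_map_carrier: "Phi_map \<sigma> m q \<alpha> B X \<in> carrier_mat m m"
  by (simp add: Phi_map_def)

lemma dim_Phi_map [simp]:
  "dim_row (Phi_map \<sigma> m q \<alpha> B X) = m" "dim_col (Phi_map \<sigma> m q \<alpha> B X) = m"
  by (simp_all add: Phi_map_def)

text \<open>The delta factors write tr(X) I as the sum of E X E^* over the m x n matrix units E,
  indexed by \<open>e\<close> and \<open>p\<close>. Both terms of the map then have the same shape
  and can be expanded into rank-one kernels in the same way.\<close>

lemma index_Phi_map:
  assumes X: "X \<in> carrier_mat n n" and B: "\<forall>s<q. B s \<in> carrier_mat m n"
    and ab: "a < m" "b < m"
  shows "Phi_map \<sigma> m q \<alpha> B X $$ (a, b)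
    = of_real \<alpha> * (\<Sum>e<m. \<Sum>p<n. (if e = a then 1 else 0) * (if e = b then 1 else 0) * X $$ (p, p))
    + of_real \<sigma> * (\<Sum>s<q. \<Sum>p<n. \<Sum>r<n. B s $$ (a, p) * X $$ (p, r) * cnj (B s $$ (b, r)))"
proof -
  have "(B s * X * mat_adjoint (B s)) $$ (a, b)
      = (\<Sum>p<n. \<Sum>r<n. B s $$ (a, p) * X $$ (p, r) * cnj (B s $$ (b, r)))" if "s < q" for s
  proof -
    note Bs = B[rule_format, OF that]
    have "(B s * X * mat_adjoint (B s)) $$ (a, b)
        = (\<Sum>r<n. \<Sum>p<n. B s $$ (a, p) * X $$ (p, r) * cnj (B s $$ (b, r)))"
      using ab by (simp add: index_mult_mat_sum[OF mult_carrier_mat[OF Bs X] mat_adjoint_carrier[OF Bs]]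
          index_mult_mat_sum[OF Bs X] index_mat_adjoint[OF Bs] sum_distrib_right del: index_mult_mat)
    also have "\<dots> = (\<Sum>p<n. \<Sum>r<n. B s $$ (a, p) * X $$ (p, r) * cnj (B s $$ (b, r)))"
      by (rule sum.swap)
    finally show ?thesis .
  qed
  moreover have "(\<Sum>e<m. \<Sum>p<n. (if e = a then 1 else 0) * (if e = b then 1 else 0) * X $$ (p, p))
      = (if a = b then mat_trace X else 0)"
  proof -
    have "(\<Sum>e<m. \<Sum>p<n. (if e = a then 1 else 0) * (if e = b then 1 else 0) * X $$ (p, p))
        = (\<Sum>e<m. if e = a then (if a = b then mat_trace X else 0) else 0)"
      using X by (intro sum.cong) (auto simp: mat_trace_def)
    then show ?thesis using ab by simp
  qed
  ultimately show ?thesis using ab by (simp add: Phi_map_def)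
qed

lemma linear_Phi_map:
  assumes B: "\<forall>s<q. B s \<in> carrier_mat m n"
  shows "linear_mat_map n m (Phi_map \<sigma> m q \<alpha> B)"
  unfolding linear_mat_map_def
proof (intro conjI ballI allI)
  fix X Y :: "complex mat" assume X: "X \<in> carrier_mat n n" and Y: "Y \<in> carrier_mat n n"
  show "Phi_map \<sigma> m q \<alpha> B (X + Y) = Phi_map \<sigma> m q \<alpha> B X + Phi_map \<sigma> m q \<alpha> B Y"
  proof (rule eq_matI)
    fix a b assume "a < dim_row (Phi_map \<sigma> m q \<alpha> B X + Phi_map \<sigma> m q \<alpha> B Y)"
      "b < dim_col (Phi_map \<sigma> m q \<alpha> B X + Phi_map \<sigma> m q \<alpha> B Y)"
    then have ab: "a < m" "b < m" by simp_all
    have "(Phi_map \<sigma> m q \<alpha> B X + Phi_map \<sigma> m q \<alpha> B Y) $$ (a, b)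
        = Phi_map \<sigma> m q \<alpha> B X $$ (a, b) + Phi_map \<sigma> m q \<alpha> B Y $$ (a, b)"
      using ab by simp
    then show "Phi_map \<sigma> m q \<alpha> B (X + Y) $$ (a, b) = (Phi_map \<sigma> m q \<alpha> B X + Phi_map \<sigma> m q \<alpha> B Y) $$ (a, b)"
      using index_Phi_map[OF X B ab] index_Phi_map[OF Y B ab]
        index_Phi_map[OF add_carrier_mat[OF Y, of X] B ab] X Y ab
      by (simp add: distrib_left distrib_right sum.distrib)
  qed simp_all
next
  fix c and X :: "complex mat" assume X: "X \<in> carrier_mat n n"
  show "Phi_map \<sigma> m q \<alpha> B (c \<cdot>\<^sub>m X) = c \<cdot>\<^sub>m Phi_map \<sigma> m q \<alpha> B X"
  proof (rule eq_matI)
    fix a b assume "a < dim_row (c \<cdot>\<^sub>m Phi_map \<sigma> m q \<alpha> B X)" "b < dim_col (c \<cdot>\<^sub>m Phi_map \<sigma> m q \<alpha> B X)"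
    then have ab: "a < m" "b < m" by simp_all
    have "(c \<cdot>\<^sub>m Phi_map \<sigma> m q \<alpha> B X) $$ (a, b) = c * Phi_map \<sigma> m q \<alpha> B X $$ (a, b)"
      using ab by simp
    then show "Phi_map \<sigma> m q \<alpha> B (c \<cdot>\<^sub>m X) $$ (a, b) = (c \<cdot>\<^sub>m Phi_map \<sigma> m q \<alpha> B X) $$ (a, b)"
      using index_Phi_map[OF X B ab]
        index_Phi_map[OF smult_carrier_mat[OF X, of c] B ab] X
      by (simp add: distrib_left sum_distrib_left mult_ac)
  qed simp_all
qed (rule Phi_map_carrier)

section \<open>Block matrices and their quadratic forms\<close>

lemma block_matrix_carrier [simp]: "block_matrix k d A \<in> carrier_mat (k * d) (k * d)"
  by (simp add: block_matrix_def)

lemma index_block_matrix: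
  assumes "r < k * d" "c < k * d"
  shows "block_matrix k d A $$ (r, c) = A (r div d) (c div d) $$ (r mod d, c mod d)"
  using assms by (simp add: block_matrix_def)

lemma block_index_less: "i < k \<Longrightarrow> p < n \<Longrightarrow> i * n + p < k * (n::nat)"
  using mult_le_mono1[of "Suc i" k n] by simp

text \<open>The matrix $\sum_i y_i x_i^*$, where \<open>y\<close> and \<open>x\<close> are the concatenations of the vectors $y_i$ and $x_i$.\<close>
definition pairing :: "nat \<Rightarrow> nat \<Rightarrow> nat \<Rightarrow> (nat \<Rightarrow> complex) \<Rightarrow> (nat \<Rightarrow> complex) \<Rightarrow> nat \<Rightarrow> nat \<Rightarrow> complex" where
  "pairing k m n y x a p = (\<Sum>i<k. y (i * m + a) * cnj (x (i * n + p)))"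

text \<open>On a rank-one block matrix with factor x, each operator K in the sum (a matrix unit or a
  \<open>B s\<close>) yields the rank-one kernel of (I_k tensor K) x. Its inner product with
  \<open>y\<close> is the conjugate of <K, W>, where W is the \<open>pairing\<close> of
  \<open>y\<close> and x.\<close>

lemma
  fixes A :: "nat \<Rightarrow> nat \<Rightarrow> complex mat" and \<alpha> \<sigma> :: real
  assumes A: "\<forall>i<k. \<forall>j<k. A i j \<in> carrier_mat n n"
    and B: "\<forall>s<q. B s \<in> carrier_mat m n"
    and g: "\<forall>r<k * n. \<forall>c<k * n.
      block_matrix k n A $$ (r, c) = (\<Sum>l<L::nat. g l r * cnj (g l c))"
  defines "M \<equiv> block_matrix k m (\<lambda>i j. Phi_map \<sigma> m q \<alpha> B (A i j))"
  shows block_Phi_map_hermitian: "\<And>r c. r < k * m \<Longrightarrow> c < k * m \<Longrightarrow> M $$ (c, r) = cnj (M $$ (r, c))"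
    and herm_form_block_Phi_map: "herm_form (k * m) (\<lambda>r c. M $$ (r, c)) y
      = of_real (\<Sum>l<L. \<alpha> * frob_sq m n (pairing k m n y (g l)) + \<sigma> * overlap m n q B (pairing k m n y (g l)))"
proof -
  \<comment> \<open>\<open>z l e p\<close> is the factor \<open>g l\<close> acted on by I_k tensor
    E, with E the matrix unit at \<open>(e, p)\<close>; \<open>w l s\<close> is the same with
    \<open>B s\<close> in place of E.\<close>
  define z where "z = (\<lambda>l e p r. (if e = r mod m then 1 else 0) * g l (r div m * n + p))"
  define w where "w = (\<lambda>l s r. \<Sum>p<n. B s $$ (r mod m, p) * g l (r div m * n + p))"
  have gA: "A i j $$ (p, p') = (\<Sum>l<L. g l (i * n + p) * cnj (g l (j * n + p')))"
    if "i < k" "j < k" "p < n" "p' < n" for i j p p'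
    using g[rule_format, OF block_index_less[OF that(1,3)] block_index_less[OF that(2,4)]] that
    by (simp add: index_block_matrix block_index_less)
  have M: "M $$ (r, c) = (\<Sum>l<L. of_real \<alpha> * (\<Sum>e<m. \<Sum>p<n. z l e p r * cnj (z l e p c))
      + of_real \<sigma> * (\<Sum>s<q. w l s r * cnj (w l s c)))"
    if r: "r < k * m" and c: "c < k * m" for r c
  proof -
    have m: "r mod m < m" "c mod m < m" using r c by (cases m; simp)+
    have d: "r div m < k" "c div m < k" using r c by (simp_all add: less_mult_imp_div_less)
    have "(\<Sum>e<m. \<Sum>p<n. (if e = r mod m then 1 else 0) * (if e = c mod m then 1 else 0) *
          A (r div m) (c div m) $$ (p, p)) = (\<Sum>e<m. \<Sum>p<n. \<Sum>l<L. z l e p r * cnj (z l e p c))"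
      by (intro sum.cong refl) (simp add: gA[OF d] z_def sum_distrib_left mult_ac)
    also have "\<dots> = (\<Sum>e<m. \<Sum>l<L. \<Sum>p<n. z l e p r * cnj (z l e p c))"
      by (intro sum.cong refl sum.swap)
    also have "\<dots> = (\<Sum>l<L. \<Sum>e<m. \<Sum>p<n. z l e p r * cnj (z l e p c))"
      by (rule sum.swap)
    finally have 1: "(\<Sum>e<m. \<Sum>p<n. (if e = r mod m then 1 else 0) * (if e = c mod m then 1 else 0) *
          A (r div m) (c div m) $$ (p, p)) = (\<Sum>l<L. \<Sum>e<m. \<Sum>p<n. z l e p r * cnj (z l e p c))" .
    let ?t = "\<lambda>s p p' l. (B s $$ (r mod m, p) * g l (r div m * n + p))
        * cnj (B s $$ (c mod m, p') * g l (c div m * n + p'))"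
    have "(\<Sum>s<q. \<Sum>p<n. \<Sum>p'<n. B s $$ (r mod m, p) * A (r div m) (c div m) $$ (p, p')
          * cnj (B s $$ (c mod m, p'))) = (\<Sum>s<q. \<Sum>p<n. \<Sum>p'<n. \<Sum>l<L. ?t s p p' l)"
      by (intro sum.cong refl) (simp add: gA[OF d] sum_distrib_left sum_distrib_right mult_ac)
    also have "\<dots> = (\<Sum>s<q. \<Sum>p<n. \<Sum>l<L. \<Sum>p'<n. ?t s p p' l)"
      by (intro sum.cong refl sum.swap)
    also have "\<dots> = (\<Sum>s<q. \<Sum>l<L. \<Sum>p<n. \<Sum>p'<n. ?t s p p' l)"
      by (intro sum.cong refl sum.swap)
    also have "\<dots> = (\<Sum>l<L. \<Sum>s<q. \<Sum>p<n. \<Sum>p'<n. ?t s p p' l)"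
      by (rule sum.swap)
    also have "\<dots> = (\<Sum>l<L. \<Sum>s<q. w l s r * cnj (w l s c))"
      unfolding w_def cnj_sum sum_product ..
    finally have 2: "(\<Sum>s<q. \<Sum>p<n. \<Sum>p'<n. B s $$ (r mod m, p) * A (r div m) (c div m) $$ (p, p')
          * cnj (B s $$ (c mod m, p'))) = (\<Sum>l<L. \<Sum>s<q. w l s r * cnj (w l s c))" .
    show ?thesis
      unfolding M_def index_block_matrix[OF r c] index_Phi_map[OF A[rule_format, OF d] B m] 1 2
      by (simp add: sum.distrib sum_distrib_left)
  qed
  show "M $$ (c, r) = cnj (M $$ (r, c))" if "r < k * m" "c < k * m" for r c
    using that by (simp add: M mult.commute)
  have z: "(\<Sum>r<k*m. cnj (y r) * z l e p r) = cnj (pairing k m n y (g l) e p)" if "e < m" for l e p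
  proof -
    have "(\<Sum>r<k*m. cnj (y r) * z l e p r)
        = (\<Sum>r<k*m. if e = r mod m then cnj (y (r div m * m + r mod m)) * g l (r div m * n + p) else 0)"
      by (intro sum.cong) (auto simp: z_def)
    also have "\<dots> = (\<Sum>i<k. \<Sum>a<m. if e = a then cnj (y (i * m + a)) * g l (i * n + p) else 0)"
      by (rule sum_div_mod[of "\<lambda>i a. if e = a then cnj (y (i * m + a)) * g l (i * n + p) else 0"])
    also have "\<dots> = cnj (pairing k m n y (g l) e p)"
      using that by (simp add: pairing_def)
    finally show ?thesis .
  qed
  have w: "(\<Sum>r<k*m. cnj (y r) * w l s r)
      = cnj (\<Sum>p<n. \<Sum>a<m. cnj (B s $$ (a, p)) * pairing k m n y (g l) a p)" for l s
  proof -
    have "(\<Sum>r<k*m. cnj (y r) * w l s r) = (\<Sum>r<k*m. \<Sum>p<n. cnj (y (r div m * m + r mod m)) *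
        (B s $$ (r mod m, p) * g l (r div m * n + p)))"
      by (simp add: w_def sum_distrib_left)
    also have "\<dots> = (\<Sum>i<k. \<Sum>a<m. \<Sum>p<n. cnj (y (i * m + a)) * (B s $$ (a, p) * g l (i * n + p)))"
      by (rule sum_div_mod[of "\<lambda>i a. \<Sum>p<n. cnj (y (i * m + a)) * (B s $$ (a, p) * g l (i * n + p))"])
    also have "\<dots> = (\<Sum>i<k. \<Sum>p<n. \<Sum>a<m. cnj (y (i * m + a)) * (B s $$ (a, p) * g l (i * n + p)))"
      by (intro sum.cong refl sum.swap)
    also have "\<dots> = (\<Sum>p<n. \<Sum>i<k. \<Sum>a<m. cnj (y (i * m + a)) * (B s $$ (a, p) * g l (i * n + p)))"
      by (rule sum.swap)
    also have "\<dots> = (\<Sum>p<n. \<Sum>a<m. \<Sum>i<k. cnj (y (i * m + a)) * (B s $$ (a, p) * g l (i * n + p)))"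
      by (intro sum.cong refl sum.swap)
    also have "\<dots> = cnj (\<Sum>p<n. \<Sum>a<m. cnj (B s $$ (a, p)) * pairing k m n y (g l) a p)"
      by (simp add: pairing_def sum_distrib_left mult_ac)
    finally show ?thesis .
  qed
  have "herm_form (k * m) (\<lambda>r c. M $$ (r, c)) y
      = herm_form (k * m) (\<lambda>r c. \<Sum>l<L. of_real \<alpha> * (\<Sum>e<m. \<Sum>p<n. z l e p r * cnj (z l e p c))
        + of_real \<sigma> * (\<Sum>s<q. w l s r * cnj (w l s c))) y"
    by (intro herm_form_cong M refl)
  also have "\<dots> = (\<Sum>l<L. of_real \<alpha> * (\<Sum>e<m. \<Sum>p<n. of_real ((cmod (\<Sum>r<k*m. cnj (y r) * z l e p r))\<^sup>2))
      + of_real \<sigma> * (\<Sum>s<q. of_real ((cmod (\<Sum>r<k*m. cnj (y r) * w l s r))\<^sup>2)))"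
    unfolding herm_form_sum herm_form_add herm_form_scale herm_form_rank_one ..
  also have "\<dots> = (\<Sum>l<L. of_real \<alpha> * of_real (frob_sq m n (pairing k m n y (g l)))
      + of_real \<sigma> * of_real (overlap m n q B (pairing k m n y (g l))))"
  proof -
    have "(\<Sum>e<m. \<Sum>p<n. of_real ((cmod (\<Sum>r<k*m. cnj (y r) * z l e p r))\<^sup>2))
        = (of_real (frob_sq m n (pairing k m n y (g l))) :: complex)" for l
      unfolding frob_sq_def of_real_sum
      by (subst sum.swap) (intro sum.cong refl, simp add: z)
    moreover have "(\<Sum>s<q. of_real ((cmod (\<Sum>r<k*m. cnj (y r) * w l s r))\<^sup>2))
        = (of_real (overlap m n q B (pairing k m n y (g l))) :: complex)" for l
      unfolding overlap_def of_real_sum w complex_mod_cnj ..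
    ultimately show ?thesis by simp
  qed
  finally show "herm_form (k * m) (\<lambda>r c. M $$ (r, c)) y
      = of_real (\<Sum>l<L. \<alpha> * frob_sq m n (pairing k m n y (g l)) + \<sigma> * overlap m n q B (pairing k m n y (g l)))"
    by simp
qed

lemma positive_semidefinite_rank_one_sum:
  assumes "positive_semidefinite N A"
  shows "\<exists>(L::nat) g. \<forall>i<N. \<forall>j<N. A $$ (i, j) = (\<Sum>l<L. g l i * cnj (g l j))"
proof -
  have "\<exists>(L::nat) g. \<forall>i\<in>{..<N}. \<forall>j\<in>{..<N}. A $$ (i, j) = (\<Sum>l<L. g l i * cnj (g l j))"
  proof (rule psd_kernel_rank_one_sum)
    show "A $$ (j, i) = cnj (A $$ (i, j))" if "i \<in> {..<N}" "j \<in> {..<N}" for i j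
      using assms that unfolding positive_semidefinite_iff lessThan_iff by blast
    show "0 \<le> Re (\<Sum>i<N. \<Sum>j<N. cnj (v i) * A $$ (i, j) * v j)" for v
      using assms unfolding positive_semidefinite_iff herm_form_def by blast
  qed simp
  then show ?thesis by (simp only: Ball_def lessThan_iff)
qed

lemma pairing_eq_frame_prod:
  assumes "k \<le> m"
  obtains V u where "orthonormal_frame m k V"
    "\<And>a p. a < m \<Longrightarrow> p < n \<Longrightarrow> pairing k m n y x a p = frame_prod k V u a p"
proof -
  obtain V R where V: "orthonormal_frame m k V"
    and R: "\<And>i a. i < k \<Longrightarrow> a < m \<Longrightarrow> y (i * m + a) = (\<Sum>l<k. V l a * R l i)"
    using orthonormal_frame_spanning[OF assms, of "\<lambda>i a. y (i * m + a)"]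
    unfolding orthonormal_frame_def by blast
  \<comment> \<open>The column stacking of U = R X^* where X has the columns x_i: position
    \<open>r\<close> holds row \<open>r mod k\<close> and column \<open>r div k\<close>.\<close>
  define u where "u = (\<lambda>r. \<Sum>i<k. R (r mod k) i * cnj (x (i * n + r div k)))"
  have "pairing k m n y x a p = frame_prod k V u a p" if "a < m" "p < n" for a p
  proof -
    have "pairing k m n y x a p = (\<Sum>i<k. \<Sum>l<k. V l a * (R l i * cnj (x (i * n + p))))"
      using that by (simp add: pairing_def R sum_distrib_right mult.assoc)
    also have "\<dots> = frame_prod k V u a p"
      by (subst sum.swap) (simp add: frame_prod_def u_def sum_distrib_left)
    finally show ?thesis .
  qed
  then show ?thesis using that V by blast
qed

theorem theorem4p2:
  fixes m n q k :: nat and \<alpha> \<sigma> :: real and B :: "nat \<Rightarrow> complex mat"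
  assumes "m \<ge> 1" and "n \<ge> 1" and "q \<ge> 1" and "1 \<le> k" and "k \<le> m"
    and "\<And>s. s < q \<Longrightarrow> B s \<in> carrier_mat m n"
    and "\<sigma> \<in> {1, -1}"
  shows "k_positive k n m (Phi_map \<sigma> m q \<alpha> B) \<longleftrightarrow> \<alpha> \<ge> beta \<sigma> k m n q B"
proof
  have B: "\<forall>s<q. B s \<in> carrier_mat m n" using assms(6) by blast
  assume kpos: "k_positive k n m (Phi_map \<sigma> m q \<alpha> B)"
  obtain V u where V: "orthonormal_frame m k V" and u: "(\<Sum>r<n*k. (cmod (u r))\<^sup>2) = 1"
    and beta: "beta \<sigma> k m n q B = - \<sigma> * overlap m n q B (frame_prod k V u)"
    using beta_attained[OF assms(4,5,2) B] by blast
  \<comment> \<open>Test data from an optimal pair: x_i is the conjugate of row i of U, and y_i is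
    column i of V, so that the sum of the y_i x_i^* is V U.\<close>
  define x where "x = (\<lambda>t. cnj (u ((t mod n) * k + t div n)))"
  define y where "y = (\<lambda>t. V (t div m) (t mod m))"
  define A where "A = (\<lambda>i j. mat n n (\<lambda>(p, r). x (i * n + p) * cnj (x (j * n + r))))"
  have A: "\<forall>i<k. \<forall>j<k. A i j \<in> carrier_mat n n" by (simp add: A_def)
  have block: "block_matrix k n A $$ (r, c) = x r * cnj (x c)" if "r < k * n" "c < k * n" for r c
    using that assms(2) by (simp add: index_block_matrix A_def)
  have "positive_semidefinite (k * n) (block_matrix k n A)"
    unfolding positive_semidefinite_iff
  proof (intro conjI allI impI)
    fix v
    have "herm_form (k * n) (\<lambda>i j. block_matrix k n A $$ (i, j)) v
        = herm_form (k * n) (\<lambda>i j. x i * cnj (x j)) v"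
      by (intro herm_form_cong block refl)
    then show "0 \<le> Re (herm_form (k * n) (\<lambda>i j. block_matrix k n A $$ (i, j)) v)"
      by (simp add: herm_form_rank_one del: of_real_power)
  qed (simp_all add: block mult.commute)
  with kpos A have "positive_semidefinite (k * m) (block_matrix k m (\<lambda>i j. Phi_map \<sigma> m q \<alpha> B (A i j)))"
    unfolding k_positive_def by blast
  then have "0 \<le> Re (herm_form (k * m) (\<lambda>r c. block_matrix k m (\<lambda>i j. Phi_map \<sigma> m q \<alpha> B (A i j)) $$ (r, c)) y)"
    unfolding positive_semidefinite_iff by blast
  also have "\<dots> = \<alpha> * frob_sq m n (pairing k m n y x) + \<sigma> * overlap m n q B (pairing k m n y x)"
    using herm_form_block_Phi_map[OF A B, where L = 1 and g = "\<lambda>_. x"] by (simp add: block)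
  also have pair: "pairing k m n y x a p = frame_prod k V u a p" if "a < m" "p < n" for a p
    using that by (simp add: pairing_def frame_prod_def x_def y_def)
  have "frob_sq m n (pairing k m n y x) = 1"
    using frob_sq_cong[OF pair] frob_sq_frame_prod[OF V] u by simp
  moreover have "overlap m n q B (pairing k m n y x) = overlap m n q B (frame_prod k V u)"
    by (rule overlap_cong[OF pair])
  ultimately show "\<alpha> \<ge> beta \<sigma> k m n q B" using beta by simp
next
  have B: "\<forall>s<q. B s \<in> carrier_mat m n" using assms(6) by blast
  assume le: "\<alpha> \<ge> beta \<sigma> k m n q B"
  have nonneg: "0 \<le> \<alpha> * frob_sq m n (pairing k m n y x) + \<sigma> * overlap m n q B (pairing k m n y x)" for y x
  proof -
    obtain V u where V: "orthonormal_frame m k V"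
      and pair: "\<And>a p. a < m \<Longrightarrow> p < n \<Longrightarrow> pairing k m n y x a p = frame_prod k V u a p"
      using pairing_eq_frame_prod[OF assms(5)] by metis
    have "- \<sigma> * overlap m n q B (frame_prod k V u) \<le> beta \<sigma> k m n q B * (\<Sum>r<n*k. (cmod (u r))\<^sup>2)"
      by (rule beta_bound[OF assms(4,5,2) B V])
    also have "\<dots> \<le> \<alpha> * (\<Sum>r<n*k. (cmod (u r))\<^sup>2)"
      using le by (intro mult_right_mono sum_nonneg) auto
    finally show ?thesis
      using frob_sq_cong[OF pair] overlap_cong[OF pair] frob_sq_frame_prod[OF V] by simp
  qed
  show "k_positive k n m (Phi_map \<sigma> m q \<alpha> B)"
    unfolding k_positive_def
  proof (intro conjI allI impI)
    show "linear_mat_map n m (Phi_map \<sigma> m q \<alpha> B)" by (rule linear_Phi_map[OF B])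
    fix A :: "nat \<Rightarrow> nat \<Rightarrow> complex mat"
    assume A: "\<forall>i<k. \<forall>j<k. A i j \<in> carrier_mat n n" and psd: "positive_semidefinite (k * n) (block_matrix k n A)"
    obtain L g where g: "\<forall>r<k * n. \<forall>c<k * n.
        block_matrix k n A $$ (r, c) = (\<Sum>l<L::nat. g l r * cnj (g l c))"
      using positive_semidefinite_rank_one_sum[OF psd] by blast
    note herm = block_Phi_map_hermitian[OF A B g]
      and form = herm_form_block_Phi_map[OF A B g]
    show "positive_semidefinite (k * m) (block_matrix k m (\<lambda>i j. Phi_map \<sigma> m q \<alpha> B (A i j)))"
      unfolding positive_semidefinite_iff form Re_complex_of_real
      by (intro conjI allI impI block_matrix_carrier herm sum_nonneg nonneg)
  qed
qed

end
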